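(* Let $K$ be an algebraically closed field of characteristic $0$. Let $P_1,\ldots,P_n$ be a star configuration of points in $\mathbf{P}^N$, where $\mathbf{P}^N$ is regarded as a linear subspace of a larger dimensional projective space $\mathbf{P}^d$ (so $d>N\ge 1$). Let $I\subset K[\mathbf{P}^d]$ be the radical ideal of the set $\{P_1,\ldots,P_n\}$ regarded as a subset of $\mathbf{P}^d$, and let $M\subset K[\mathbf{P}^d]$ be the ideal generated by the variables. Then for all $r\geq 1$: (a) $I^{(rd)}\subseteq M^{r(d-1)}I^r$; and (b) $I^{(rd-(d-1))}\subseteq M^{(r-1)(d-1)}I^r$.
   Context: A star configuration of points in $\mathbf{P}^N$ is the set of $\binom{s}{N}$ points obtained from $s\geq N$ hyperplanes of $\mathbf{P}^N$, where any $N$ of the hyperplanes meet in exactly one point and no $N+1$ of them have a common point, by taking all the intersection points of $N$ of the hyperplanes. For a finite set of points $P_1,\ldots,P_n\in\mathbf{P}^d$ with radical ideal $I=\bigcap_i I(P_i)$, where $I(P_i)\subset K[\mathbf{P}^d]$ is the ideal generated by all forms vanishing at $P_i$, the $m$-th symbolic power is $I^{(m)}=\bigcap_i I(P_i)^m$. For any ideal $J$, $J^0$ is the whole ring. *)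

theory Defs
  imports
    "HOL-Analysis.Cartesian_Space"
    "HOL-Library.Poly_Mapping"
    "HOL-Algebra.Ideal_Product"
    "HOL-Algebra.Algebraic_Closure_Type"
begin

text \<open>
  Variables and homogeneous coordinates are indexed by a finite type \<open>'v\<close>, so that
  \<open>\<P>\<^sup>d\<close> is the projective space of \<open>'k^'v\<close> with \<open>CARD('v) = d + 1\<close>, and its homogeneous
  coordinate ring is the polynomial ring in the variables \<open>'v\<close>: finitely supported coefficient
  functions on exponent vectors, with the convolution product of \<open>poly_mapping\<close>.
\<close>

type_synonym ('k, 'v) mpoly = "('v \<Rightarrow>\<^sub>0 nat) \<Rightarrow>\<^sub>0 'k"

definition poly_var :: "'v \<Rightarrow> ('k::field, 'v::finite) mpoly" where
  "poly_var v = Poly_Mapping.single (Poly_Mapping.single v 1) 1"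

definition poly_eval :: "'k^'v \<Rightarrow> ('k::field, 'v::finite) mpoly \<Rightarrow> 'k" where
  "poly_eval x f =
     (\<Sum>m\<in>Poly_Mapping.keys f.
        Poly_Mapping.lookup f m * (\<Prod>v\<in>UNIV. (x $ v) ^ Poly_Mapping.lookup m v))"

definition is_form :: "('k::field, 'v::finite) mpoly \<Rightarrow> bool" where
  "is_form f \<longleftrightarrow>
     (\<exists>n. \<forall>m\<in>Poly_Mapping.keys f. (\<Sum>v\<in>UNIV. Poly_Mapping.lookup m v) = n)"

abbreviation coord_ring :: "('k::field, 'v::finite) mpoly ring" where
  "coord_ring \<equiv> ring_of_type_algebra"

text \<open>
  The ideals of \<open>coord_ring\<close> form the semiring \<open>ideals_set coord_ring\<close>, whose multiplication is
  the product of ideals and whose unit is the whole ring; in particular \<open>ideal_pow J 0\<close> is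
  the whole ring.
\<close>

abbreviation ideal_mult ::
    "('k::field, 'v::finite) mpoly set \<Rightarrow> ('k, 'v) mpoly set \<Rightarrow> ('k, 'v) mpoly set" where
  "ideal_mult J J' \<equiv> J \<otimes>\<^bsub>ideals_set coord_ring\<^esub> J'"

abbreviation ideal_pow ::
    "('k::field, 'v::finite) mpoly set \<Rightarrow> nat \<Rightarrow> ('k, 'v) mpoly set" where
  "ideal_pow J n \<equiv> J [^]\<^bsub>ideals_set coord_ring\<^esub> n"

text \<open>
  Projective points are represented as lines through the origin of \<open>'k^'v\<close>.  A linear
  subspace of projective space is represented by the linear subspace \<open>W\<close> of \<open>'k^'v\<close> above it,
  and \<open>proj_points W\<close> is the set of its points.
\<close>

definition proj_points :: "('k::field^'v::finite) set \<Rightarrow> ('k^'v) set set" where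
  "proj_points W = {L. vec.subspace L \<and> vec.dim L = 1 \<and> L \<subseteq> W}"

definition proj_subspace :: "nat \<Rightarrow> ('k::field^'v::finite) set \<Rightarrow> bool" where
  "proj_subspace N W \<longleftrightarrow> vec.subspace W \<and> vec.dim W = N + 1"

definition proj_hyperplane_of ::
    "('k::field^'v::finite) set \<Rightarrow> ('k^'v) set \<Rightarrow> bool" where
  "proj_hyperplane_of W H \<longleftrightarrow> vec.subspace H \<and> H \<subseteq> W \<and> vec.dim H + 1 = vec.dim W"

text \<open>
  \<open>Z\<close> is a star configuration of points in the \<open>N\<close>-dimensional linear subspace \<open>W\<close>
  (meaningful for \<open>N \<ge> 1\<close> only, since the families \<open>T\<close> below must be nonempty).
\<close>

definition star_configuration ::
    "nat \<Rightarrow> ('k::field^'v::finite) set \<Rightarrow> ('k^'v) set set \<Rightarrow> bool" where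
  "star_configuration N W Z \<longleftrightarrow>
     proj_subspace N W \<and>
     (\<exists>\<H>. finite \<H> \<and> N \<le> card \<H> \<and> (\<forall>H\<in>\<H>. proj_hyperplane_of W H) \<and>
        (\<forall>T. T \<subseteq> \<H> \<and> card T = N \<longrightarrow> (\<exists>P. (\<Inter>H\<in>T. proj_points H) = {P})) \<and>
        (\<forall>T. T \<subseteq> \<H> \<and> card T = N + 1 \<longrightarrow> (\<Inter>H\<in>T. proj_points H) = {}) \<and>
        Z = (\<Union>T\<in>{T. T \<subseteq> \<H> \<and> card T = N}. \<Inter>H\<in>T. proj_points H))"

definition point_ideal :: "('k::field^'v::finite) set \<Rightarrow> ('k, 'v) mpoly set" where
  "point_ideal P = Idl\<^bsub>coord_ring\<^esub> {f. is_form f \<and> (\<forall>x\<in>P. poly_eval x f = 0)}"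

definition radical_ideal :: "('k::field^'v::finite) set set \<Rightarrow> ('k, 'v) mpoly set" where
  "radical_ideal Z = (\<Inter>P\<in>Z. point_ideal P)"

definition symbolic_power ::
    "('k::field^'v::finite) set set \<Rightarrow> nat \<Rightarrow> ('k, 'v) mpoly set" where
  "symbolic_power Z m = (\<Inter>P\<in>Z. ideal_pow (point_ideal P) m)"

definition irrelevant_ideal :: "('k::field, 'v::finite) mpoly set" where
  "irrelevant_ideal = Idl\<^bsub>coord_ring\<^esub> (range poly_var)"

end

theory Submission
  imports Defs
begin

text \<open>
  The points of the configuration are cut out by sets of \<open>d\<close> linear forms: equations \<open>Y\<close> of the
  \<open>N\<close>-dimensional subspace together with \<open>N\<close> of the hyperplane forms \<open>A\<close>.  The symbolic power
  \<open>I\<^sup>(\<^sup>m\<^sup>)\<close> is generated by monomials in the forms \<open>Y \<union> A\<close>, namely by those of degree at least \<open>m\<close>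
  in the forms of every point.  This reduces the containments to a count: if \<open>m > (r - 1) d\<close>, such a
  monomial is a product of \<open>r\<close> elements of \<open>I\<close>, each a form in \<open>Y\<close> or a product of
  \<open>card A - N + 1\<close> forms in \<open>A\<close>, and at least \<open>m - r\<close> further linear forms.  Both parts are
  instances of \<open>I\<^sup>(\<^sup>m\<^sup>) \<subseteq> M\<^bsup>m - r\<^esup> I\<^sup>r\<close>.
\<close>

section \<open>Ideals generated by sets\<close>

text \<open>The obstacle is that the forms in \<open>Y \<union> A\<close> are in general linearly
  dependent: no change of coordinates turns all of them into variables at once, so the intersection
  over the points cannot be read off from exponent vectors. What is available is that
  \<open>Y\<close> together with \<open>N + 1\<close> forms of \<open>A\<close> is independent,
  because \<open>N + 1\<close> of the hyperplanes have no common point. This is just enough to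
  divide by one further form at one point at a time, whence an induction that divides out single
  forms and records them in weights. A subset of \<open>A\<close> of size
  \<open>card A - N + 1\<close> meets every subset of size \<open>N\<close>, and each point lies on
  \<open>N\<close> of the hyperplanes; so the product of such a subset vanishes at every point and
  lies in \<open>I\<close>. Its degree may be large, yet the exponent \<open>m - r\<close> of
  \<open>M\<close> does not suffer: some point of the configuration is such that the
  \<open>r\<close> factors from \<open>I\<close> use up only \<open>r\<close> of the forms through
  it.\<close>

inductive_set idl :: "'a::comm_ring_1 set \<Rightarrow> 'a set" for G where
  idl_zero: "0 \<in> idl G"
| idl_step: "x \<in> idl G \<Longrightarrow> g \<in> G \<Longrightarrow> x + r * g \<in> idl G"

lemma idl_add:
  assumes "x \<in> idl G" "y \<in> idl G"
  shows "x + y \<in> idl G"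
  using assms(2,1)
proof (induction y rule: idl.induct)
  case (idl_step y g r)
  then show ?case using idl.idl_step[of "x + y" G g r] by (simp add: add.assoc)
next
  case idl_zero
  then show ?case by simp
qed

lemma idl_mult: "x \<in> idl G \<Longrightarrow> r * x \<in> idl G"
proof (induction x rule: idl.induct)
  case (idl_step y g q)
  then show ?case using idl.idl_step[of "r * y" G g "r * q"] by (simp add: algebra_simps)
qed (simp add: idl_zero)

lemma idl_base: "g \<in> G \<Longrightarrow> g \<in> idl G"
  using idl_step[OF idl_zero, of g G 1] by simp

lemma idl_diff: "x \<in> idl G \<Longrightarrow> y \<in> idl G \<Longrightarrow> x - y \<in> idl G"
  using idl_add[of x G "- 1 * y"] idl_mult[of y G "- 1"] by simp

lemma idl_sum: "(\<And>i. i \<in> I \<Longrightarrow> f i \<in> idl G) \<Longrightarrow> sum f I \<in> idl G"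
  by (induction I rule: infinite_finite_induct) (auto intro: idl_zero idl_add)

lemma idl_least: "x \<in> idl G \<Longrightarrow> (\<And>g. g \<in> G \<Longrightarrow> g \<in> idl H) \<Longrightarrow> x \<in> idl H"
  by (induction x rule: idl.induct) (auto intro: idl_zero idl_add idl_mult)

lemma idl_mono: "G \<subseteq> H \<Longrightarrow> idl G \<subseteq> idl H"
  using idl_least idl_base by blast

text \<open>For \<open>h = lin s\<close> this turns membership modulo \<open>lin s\<close> into an
  explicit remainder and cofactor; the cofactor is then treated by induction.\<close>

lemma idl_insert:
  assumes "x \<in> idl (insert h G)"
  shows "\<exists>a\<in>idl G. \<exists>r. x = a + r * h"
  using assms
proof (induction x rule: idl.induct)
  case idl_zero
  have "0 = 0 + 0 * h" by simp
  then show ?case using idl.idl_zero by blast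
next
  case (idl_step x g r)
  then obtain a q where a: "a \<in> idl G" "x = a + q * h" by blast
  show ?case
  proof (cases "g = h")
    case True
    then have "x + r * g = a + (q + r) * h" using a by (simp add: algebra_simps)
    then show ?thesis using a by blast
  next
    case False
    then have "a + r * g \<in> idl G" "x + r * g = (a + r * g) + q * h"
      using a False idl_step.hyps by (auto intro: idl.idl_step simp: add_ac)
    then show ?thesis by blast
  qed
qed

section \<open>Substitution in polynomials\<close>

lemma poly_mapping_sum_monomials:
  "f = (\<Sum>m\<in>Poly_Mapping.keys f. Poly_Mapping.single m (Poly_Mapping.lookup f m))"
  by (rule poly_mapping_eqI)
     (auto simp: lookup_sum lookup_single when_def sum.delta in_keys_iff)

lemma single_eq_const_times_vars:
  "Poly_Mapping.single m c
     = Poly_Mapping.single 0 c * (\<Prod>v\<in>UNIV. poly_var v ^ Poly_Mapping.lookup m v)"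
  for m :: "'v::finite \<Rightarrow>\<^sub>0 nat" and c :: "'k::field"
proof -
  have pow: "(poly_var v :: ('k, 'v) mpoly) ^ n = Poly_Mapping.single (Poly_Mapping.single v n) 1"
    for v n
  proof (induction n)
    case (Suc n)
    have "Poly_Mapping.single v 1 + Poly_Mapping.single v n = Poly_Mapping.single v (Suc n)"
      by (simp flip: single_add)
    then show ?case using Suc by (simp add: poly_var_def mult_single)
  qed simp
  have prod: "(\<Prod>v\<in>S. Poly_Mapping.single (p v) 1) = Poly_Mapping.single (\<Sum>v\<in>S. p v) (1 :: 'k)"
    for S and p :: "'v \<Rightarrow> ('v \<Rightarrow>\<^sub>0 nat)"
    by (induction S rule: infinite_finite_induct) (auto simp: mult_single)
  have "(\<Sum>v\<in>UNIV. Poly_Mapping.single v (Poly_Mapping.lookup m v)) = m"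
    by (rule poly_mapping_eqI) (simp add: lookup_sum lookup_single when_def)
  then show ?thesis by (simp add: pow prod mult_single)
qed

text \<open>Constants and variables generate the polynomial ring, so properties stable under sums
  and products, such as the agreement of two ring homomorphisms, need checking only there.\<close>

lemma mpoly_induct [case_names const var add mult]:
  fixes f :: "('k::field, 'v::finite) mpoly"
  assumes const: "\<And>c. P (Poly_Mapping.single 0 c)"
    and var: "\<And>v. P (poly_var v)"
    and add: "\<And>f g. P f \<Longrightarrow> P g \<Longrightarrow> P (f + g)"
    and mult: "\<And>f g. P f \<Longrightarrow> P g \<Longrightarrow> P (f * g)"
  shows "P f"
proof -
  have one: "P 1" using const[of 1] by simp
  have pow: "P (poly_var v ^ n)" for v n
    by (induction n) (auto intro: one var mult)
  have prod: "P (\<Prod>v\<in>S. poly_var v ^ n v)" for S and n :: "'v \<Rightarrow> nat"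
    by (induction S rule: infinite_finite_induct) (auto intro: one pow mult)
  have single: "P (Poly_Mapping.single m c)" for m c
    by (subst single_eq_const_times_vars) (intro mult const prod)
  have zero: "P 0" using const[of 0] by simp
  have "P (\<Sum>m\<in>S. Poly_Mapping.single m (Poly_Mapping.lookup f m))" for S
    by (induction S rule: infinite_finite_induct) (auto intro: zero single add)
  then show ?thesis by (subst poly_mapping_sum_monomials)
qed

text \<open>The algebra endomorphism sending each variable \<open>v\<close> to
  \<open>\<tau> v\<close>. As \<open>\<tau>\<close> may take any polynomial values, it covers
  changes of coordinates, evaluation at a point and restriction to a line.\<close>

definition psubst :: "('v \<Rightarrow> ('k, 'v) mpoly) \<Rightarrow> ('k::field, 'v::finite) mpoly \<Rightarrow> ('k, 'v) mpoly" where
  "psubst \<tau> f = (\<Sum>m\<in>Poly_Mapping.keys f. Poly_Mapping.single 0 (Poly_Mapping.lookup f m) *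
     (\<Prod>v\<in>UNIV. \<tau> v ^ Poly_Mapping.lookup m v))"

lemma psubst_add: "psubst \<tau> (f + g) = psubst \<tau> f + psubst \<tau> g"
  unfolding psubst_def
  by (rule setsum_keys_plus_distrib) (simp_all add: single_add algebra_simps)

lemma psubst_single:
  "psubst \<tau> (Poly_Mapping.single m c)
     = Poly_Mapping.single 0 c * (\<Prod>v\<in>UNIV. \<tau> v ^ Poly_Mapping.lookup m v)"
  by (simp add: psubst_def)

lemma psubst_zero [simp]: "psubst \<tau> 0 = 0"
  by (simp add: psubst_def)

lemma psubst_sum: "psubst \<tau> (\<Sum>i\<in>I. f i) = (\<Sum>i\<in>I. psubst \<tau> (f i))"
  by (induction I rule: infinite_finite_induct) (auto simp: psubst_add)

lemma psubst_mult:
  fixes f g :: "('a::field, 'b::finite) mpoly"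
  shows "psubst \<tau> (f * g) = psubst \<tau> f * psubst \<tau> g"
proof -
  have single: "psubst \<tau> (Poly_Mapping.single m c * Poly_Mapping.single n d)
      = psubst \<tau> (Poly_Mapping.single m c) * psubst \<tau> (Poly_Mapping.single n d)" for m c n d
  proof -
    have "Poly_Mapping.single 0 (c * d) = (Poly_Mapping.single 0 c * Poly_Mapping.single 0 d :: ('a, 'b) mpoly)"
      by (simp add: mult_single)
    then show ?thesis
      by (simp add: psubst_single mult_single[of m] lookup_add power_add prod.distrib)
  qed
  have "psubst \<tau> (f * g) = psubst \<tau>
      ((\<Sum>m\<in>Poly_Mapping.keys f. Poly_Mapping.single m (Poly_Mapping.lookup f m)) *
       (\<Sum>m\<in>Poly_Mapping.keys g. Poly_Mapping.single m (Poly_Mapping.lookup g m)))"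
    by (simp flip: poly_mapping_sum_monomials)
  also have "\<dots> = psubst \<tau> (\<Sum>m\<in>Poly_Mapping.keys f. Poly_Mapping.single m (Poly_Mapping.lookup f m)) *
       psubst \<tau> (\<Sum>m\<in>Poly_Mapping.keys g. Poly_Mapping.single m (Poly_Mapping.lookup g m))"
    by (simp add: sum_product psubst_sum single)
  finally show ?thesis
    by (simp flip: poly_mapping_sum_monomials)
qed

lemma psubst_one [simp]: "psubst \<tau> 1 = 1"
  using psubst_single[of \<tau> 0 1] by simp

lemma psubst_const [simp]: "psubst \<tau> (Poly_Mapping.single 0 c) = Poly_Mapping.single 0 c"
  by (simp add: psubst_single)

lemma psubst_var [simp]: "psubst \<tau> (poly_var v) = \<tau> v"
proof -
  have "(\<Prod>w\<in>UNIV. \<tau> w ^ Poly_Mapping.lookup (Poly_Mapping.single v 1) w) = (\<Prod>w\<in>UNIV. if w = v then \<tau> v else 1)"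
    by (rule prod.cong) (auto simp: lookup_single when_def)
  then show ?thesis by (simp add: poly_var_def psubst_single)
qed

lemma psubst_power: "psubst \<tau> (f ^ n) = psubst \<tau> f ^ n"
  by (induction n) (auto simp: psubst_mult)

lemma psubst_prod: "psubst \<tau> (\<Prod>i\<in>I. f i) = (\<Prod>i\<in>I. psubst \<tau> (f i))"
  by (induction I rule: infinite_finite_induct) (auto simp: psubst_mult)

section \<open>Linear forms and changes of coordinates\<close>

text \<open>Forms are named by their coefficient vectors, so that span and independence of forms are
  the library notions for \<open>'k^'v\<close>.\<close>

definition lin :: "'k^'v \<Rightarrow> ('k::field, 'v::finite) mpoly" where
  "lin a = (\<Sum>v\<in>UNIV. Poly_Mapping.single 0 (a $ v) * poly_var v)"

lemma lin_axis [simp]: "lin (axis v 1) = (poly_var v :: ('k::field, 'v::finite) mpoly)"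
proof -
  have "lin (axis v 1) = (\<Sum>w\<in>UNIV. if w = v then poly_var v else (0 :: ('k, 'v) mpoly))"
    unfolding lin_def by (rule sum.cong) (auto simp: axis_def)
  then show ?thesis by simp
qed

lemma lin_zero [simp]: "lin 0 = 0"
  by (simp add: lin_def)

lemma lin_add: "lin (a + b) = lin a + lin b"
  by (simp add: lin_def single_add algebra_simps sum.distrib)

lemma lin_scale: "lin (c *s a) = Poly_Mapping.single 0 c * lin a"
  by (simp add: lin_def sum_distrib_left mult_single mult.assoc[symmetric])

lemma lin_sum: "lin (\<Sum>i\<in>I. f i) = (\<Sum>i\<in>I. lin (f i))"
  by (induction I rule: infinite_finite_induct) (auto simp: lin_add)

lemma lin_span: "a \<in> vec.span S \<Longrightarrow> lin a \<in> idl (lin ` S)"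
proof (induction a rule: vec.span_induct_alt)
  case base
  then show ?case by (simp add: idl_zero)
next
  case (step c x y)
  then show ?case unfolding lin_add lin_scale by (blast intro: idl_add idl_mult idl_base)
qed

lemma psubst_lin:
  assumes "Vector_Spaces.linear (*s) (*s) g"
  shows "psubst (\<lambda>v. lin (g (axis v 1))) (lin a) = lin (g a)"
proof -
  interpret g: Vector_Spaces.linear "(*s)" "(*s)" g by fact
  have "g a = g (\<Sum>v\<in>UNIV. (a $ v) *s axis v 1)" by (simp add: basis_expansion)
  also have "\<dots> = (\<Sum>v\<in>UNIV. (a $ v) *s g (axis v 1))"
    by (simp add: g.sum g.scale)
  finally show ?thesis
    by (simp add: lin_sum lin_scale lin_def[of a] psubst_sum psubst_mult)
qed

text \<open>An independent set extends to a basis \<open>V\<close> with \<open>CARD('v)\<close>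
  elements, which a bijection \<open>\<gamma>\<close> matches with the axes; \<open>g\<close> is the
  resulting change of basis and \<open>h\<close> undoes it.\<close>

lemma independent_to_axes:
  fixes U :: "('k::field^'v::finite) set"
  assumes "vec.independent U"
  obtains g h :: "'k^'v \<Rightarrow> 'k^'v" and \<gamma> :: "'k^'v \<Rightarrow> 'v"
  where "Vector_Spaces.linear (*s) (*s) g" "Vector_Spaces.linear (*s) (*s) h" "\<And>x. h (g x) = x"
    "\<And>a. a \<in> U \<Longrightarrow> g a = axis (\<gamma> a) 1" "inj_on \<gamma> U"
proof -
  obtain V where V: "U \<subseteq> V" "vec.independent V" "UNIV \<subseteq> vec.span V"
    using vec.maximal_independent_subset_extend[OF subset_UNIV assms] by auto
  have "finite V" using vec.finiteI_independent V by blast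
  moreover have "card V = CARD('v)"
    using vec.basis_card_eq_dim[of V UNIV] V card_cart_basis[where ?'a='k and ?'i='v]
    by (simp add: vec.dim_UNIV)
  ultimately obtain \<gamma> where \<gamma>: "bij_betw \<gamma> V (UNIV :: 'v set)"
    using finite_same_card_bij[of V "UNIV :: 'v set"] by auto
  obtain g :: "'k^'v \<Rightarrow> 'k^'v" where g: "Vector_Spaces.linear (*s) (*s) g" "\<forall>a\<in>V. g a = axis (\<gamma> a) 1"
    using vec.linear_independent_extend[OF V(2), of "\<lambda>a. axis (\<gamma> a) 1"] by blast
  \<comment> \<open>The index of an axis vector is read back by \<open>SOME\<close>, which is
    unambiguous because distinct indices give distinct axes.\<close>
  obtain h :: "'k^'v \<Rightarrow> 'k^'v" where h: "Vector_Spaces.linear (*s) (*s) h"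
      "\<forall>b\<in>cart_basis. h b = the_inv_into V \<gamma> (SOME i. b = axis i 1)"
    using vec.linear_independent_extend[OF independent_cart_basis,
        of "\<lambda>b. the_inv_into V \<gamma> (SOME i. b = axis i 1)"] by blast
  have h': "h (axis i 1) = the_inv_into V \<gamma> i" for i
  proof -
    have "(SOME j. axis i 1 = (axis j 1 :: 'k^'v)) = i" by (simp add: axis_eq_axis)
    moreover have "axis i 1 \<in> (cart_basis :: ('k^'v) set)" by (auto simp: cart_basis_def)
    ultimately show ?thesis using h(2) by simp
  qed
  have "h (g a) = a" if "a \<in> V" for a
    using that g h' \<gamma> by (simp add: the_inv_into_f_f bij_betw_def)
  moreover have "Vector_Spaces.linear (*s) (*s) (h \<circ> g)"
    by (rule Vector_Spaces.linear_compose[OF g(1) h(1)])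
  moreover have "Vector_Spaces.linear (*s) (*s) (id :: 'k^'v \<Rightarrow> 'k^'v)"
    by (rule vec.linear_id)
  ultimately have "(h \<circ> g) x = id x" for x
    using vec.linear_eq_on[of "h \<circ> g" id x V] V by auto
  then have "h (g x) = x" for x by simp
  then show ?thesis
    using that g h V(1) \<gamma> by (metis (no_types, lifting) bij_betw_def inj_on_subset subsetD)
qed

section \<open>Monomials in linear forms and order of vanishing\<close>

definition mon :: "('k^'v) set \<Rightarrow> ('k^'v \<Rightarrow> nat) \<Rightarrow> ('k::field, 'v::finite) mpoly" where
  "mon E e = (\<Prod>a\<in>E. lin a ^ e a)"

text \<open>For finite \<open>T\<close> this is the \<open>k\<close>-th power of the ideal generated
  by the forms in \<open>T\<close>, plus the ideal of the forms in \<open>B\<close>. For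
  \<open>k = 0\<close> it is the whole ring, since zero exponents give \<open>1\<close>; a truncated
  order such as \<open>m - sum c T = 0\<close> thus means an empty condition.\<close>

definition vanishing_ideal :: "('k^'v) set \<Rightarrow> nat \<Rightarrow> ('k^'v) set \<Rightarrow> ('k::field, 'v::finite) mpoly set" where
  "vanishing_ideal T k B = idl ({mon T e | e. k \<le> sum e T} \<union> lin ` B)"

text \<open>The same ideal when the forms are variables, described by a test on each exponent vector
  separately. Unlike a description by generators, this lets division by a variable be followed term
  by term.\<close>

definition monomial_vanishing :: "'v set \<Rightarrow> nat \<Rightarrow> 'v set \<Rightarrow> ('k::field, 'v::finite) mpoly set" where
  "monomial_vanishing T k B = {f. \<forall>m\<in>Poly_Mapping.keys f.
     k \<le> (\<Sum>v\<in>T. Poly_Mapping.lookup m v) \<or> (\<exists>b\<in>B. 0 < Poly_Mapping.lookup m b)}"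

lemma monomial_vanishing_add:
  "f \<in> monomial_vanishing T k B \<Longrightarrow> g \<in> monomial_vanishing T k B \<Longrightarrow> f + g \<in> monomial_vanishing T k B"
  using keys_add[of f g] unfolding monomial_vanishing_def by blast

lemma monomial_vanishing_mult:
  assumes "f \<in> monomial_vanishing T k B" "g \<in> monomial_vanishing T l B"
  shows "f * g \<in> monomial_vanishing T (k + l) B"
  unfolding monomial_vanishing_def
proof (intro CollectI ballI)
  fix m assume "m \<in> Poly_Mapping.keys (f * g)"
  then obtain a b where ab: "m = a + b" "a \<in> Poly_Mapping.keys f" "b \<in> Poly_Mapping.keys g"
    using keys_mult[of f g] by blast
  show "k + l \<le> (\<Sum>v\<in>T. Poly_Mapping.lookup m v) \<or> (\<exists>b\<in>B. 0 < Poly_Mapping.lookup m b)"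
    using ab assms unfolding monomial_vanishing_def
    by (fastforce simp: lookup_add sum.distrib intro: add_mono)
qed

lemma monomial_vanishing_0: "f \<in> monomial_vanishing T 0 B"
  by (simp add: monomial_vanishing_def)

lemma monomial_vanishing_antimono:
  "k \<le> l \<Longrightarrow> monomial_vanishing T l B \<subseteq> monomial_vanishing T k B"
  unfolding monomial_vanishing_def using order_trans by blast

lemma monomial_vanishing_var: "v \<in> T \<Longrightarrow> finite T \<Longrightarrow> poly_var v \<in> monomial_vanishing T 1 B"
  by (auto simp: monomial_vanishing_def poly_var_def lookup_single when_def)

lemma monomial_vanishing_var_base: "b \<in> B \<Longrightarrow> poly_var b \<in> monomial_vanishing T k B"
  by (fastforce simp: monomial_vanishing_def poly_var_def)

lemma monomial_vanishing_power:
  "f \<in> monomial_vanishing T k B \<Longrightarrow> f ^ n \<in> monomial_vanishing T (n * k) B"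
  by (induction n) (auto intro: monomial_vanishing_mult monomial_vanishing_0)

lemma monomial_vanishing_prod:
  "(\<And>i. i \<in> I \<Longrightarrow> f i \<in> monomial_vanishing T (k i) B) \<Longrightarrow>
     (\<Prod>i\<in>I. f i) \<in> monomial_vanishing T (\<Sum>i\<in>I. k i) B"
  by (induction I rule: infinite_finite_induct) (auto intro: monomial_vanishing_mult monomial_vanishing_0)

text \<open>Multiplication by a variable shifts exponent vectors injectively, so no terms cancel.
  The shift changes the degree in \<open>T\<close> only if \<open>s \<in> T\<close>, and since
  \<open>s \<notin> B\<close> it does not affect which variables of \<open>B\<close> occur.\<close>

lemma monomial_vanishing_cancel:
  fixes f :: "('k::field, 'v::finite) mpoly"
  assumes "poly_var s * f \<in> monomial_vanishing T k B" "s \<notin> B"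
  shows "f \<in> monomial_vanishing T (if s \<in> T then k - 1 else k) B"
  unfolding monomial_vanishing_def
proof (intro CollectI ballI)
  fix m assume m: "m \<in> Poly_Mapping.keys f"
  let ?m = "Poly_Mapping.single s 1 + m"
  have "Poly_Mapping.lookup (poly_var s * f) ?m = Poly_Mapping.lookup f m"
    by (simp add: poly_var_def lookup_mult lookup_single when_mult)
  then have "?m \<in> Poly_Mapping.keys (poly_var s * f)" using m by (simp add: in_keys_iff)
  then have "k \<le> (\<Sum>v\<in>T. Poly_Mapping.lookup ?m v) \<or> (\<exists>b\<in>B. 0 < Poly_Mapping.lookup ?m b)"
    using assms(1) unfolding monomial_vanishing_def by blast
  moreover have "(\<Sum>v\<in>T. Poly_Mapping.lookup ?m v)
      = (if s \<in> T then 1 else 0) + (\<Sum>v\<in>T. Poly_Mapping.lookup m v)"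
    by (simp add: lookup_add lookup_single when_def sum.distrib)
  moreover have "Poly_Mapping.lookup ?m b = Poly_Mapping.lookup m b" if "b \<in> B" for b
    using that assms(2) by (auto simp: lookup_add lookup_single when_def)
  ultimately show "(if s \<in> T then k - 1 else k) \<le> (\<Sum>v\<in>T. Poly_Mapping.lookup m v)
      \<or> (\<exists>b\<in>B. 0 < Poly_Mapping.lookup m b)"
    by (auto split: if_splits)
qed

text \<open>
  In coordinates extending the given independent forms the ideals are spanned by monomials, where
  division by a variable is a shift of exponents.
\<close>

lemma vanishing_ideal_cancel:
  fixes s :: "'k::field^'v::finite"
  assumes ind: "vec.independent (insert s T \<union> B)" and sB: "s \<notin> B"
    and f: "lin s * f \<in> vanishing_ideal T k B"
  shows "f \<in> vanishing_ideal T (if s \<in> T then k - 1 else k) B"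
proof -
  let ?U = "insert s T \<union> B"
  obtain g h :: "'k^'v \<Rightarrow> 'k^'v" and \<gamma> :: "'k^'v \<Rightarrow> 'v" where
    g: "Vector_Spaces.linear (*s) (*s) g" and h: "Vector_Spaces.linear (*s) (*s) h"
    and hg: "\<And>x. h (g x) = x"
    and \<gamma>: "\<And>a. a \<in> ?U \<Longrightarrow> g a = axis (\<gamma> a) 1" and inj: "inj_on \<gamma> ?U"
    using independent_to_axes[OF ind] by metis
  have h\<gamma>: "h (axis (\<gamma> a) 1) = a" if "a \<in> ?U" for a
    using \<gamma>[OF that] hg[of a] by simp
  have finT: "finite T" using vec.finiteI_independent[OF ind] by simp
  let ?\<psi> = "psubst (\<lambda>v. lin (g (axis v 1)))" and ?\<phi> = "psubst (\<lambda>v. lin (h (axis v 1)))"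
  \<comment> \<open>Both substitutions are ring homomorphisms, so it is enough to compare on
    constants and variables, where \<open>hg\<close> applies.\<close>
  have inv: "?\<phi> (?\<psi> x) = x" for x
    by (induction x rule: mpoly_induct)
       (simp_all add: psubst_add psubst_mult psubst_lin[OF h] hg)
  have \<psi>_lin: "?\<psi> (lin a) = poly_var (\<gamma> a)" if "a \<in> ?U" for a
    using that by (simp add: psubst_lin[OF g] \<gamma>)
  have \<psi>_in: "?\<psi> x \<in> monomial_vanishing (\<gamma> ` T) k (\<gamma> ` B)" if "x \<in> vanishing_ideal T k B" for x
    using that unfolding vanishing_ideal_def
  proof (induction x rule: idl.induct)
    case idl_zero
    then show ?case by (simp add: monomial_vanishing_def)
  next
    case (idl_step x y r)
    have "?\<psi> y \<in> monomial_vanishing (\<gamma> ` T) k (\<gamma> ` B)"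
    proof (cases "y \<in> lin ` B")
      case True
      then obtain b where "b \<in> B" "y = lin b" by blast
      then show ?thesis using monomial_vanishing_var_base[of "\<gamma> b" "\<gamma> ` B"] by (simp add: \<psi>_lin)
    next
      case False
      then obtain e where e: "y = mon T e" "k \<le> sum e T" using idl_step.hyps by blast
      have "?\<psi> y = (\<Prod>a\<in>T. poly_var (\<gamma> a) ^ e a)"
        unfolding e mon_def psubst_prod psubst_power by (rule prod.cong) (simp_all add: \<psi>_lin)
      moreover have "poly_var (\<gamma> a) ^ e a \<in> monomial_vanishing (\<gamma> ` T) (e a) (\<gamma> ` B)" if "a \<in> T" for a
        using monomial_vanishing_power[OF monomial_vanishing_var[of "\<gamma> a" "\<gamma> ` T" "\<gamma> ` B"], of "e a"] that finT by simp
      then have "(\<Prod>a\<in>T. poly_var (\<gamma> a) ^ e a) \<in> monomial_vanishing (\<gamma> ` T) (sum e T) (\<gamma> ` B)"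
        by (rule monomial_vanishing_prod)
      ultimately have "?\<psi> y \<in> monomial_vanishing (\<gamma> ` T) (sum e T) (\<gamma> ` B)"
        by simp
      then show ?thesis using monomial_vanishing_antimono[OF e(2)] by blast
    qed
    then show ?case
      using idl_step.IH monomial_vanishing_mult[OF monomial_vanishing_0, of "?\<psi> y"]
      by (auto simp: psubst_add psubst_mult intro: monomial_vanishing_add)
  qed
  have \<phi>_in: "?\<phi> x \<in> vanishing_ideal T j B" if x: "x \<in> monomial_vanishing (\<gamma> ` T) j (\<gamma> ` B)" for x j
    unfolding psubst_def[of _ x] vanishing_ideal_def
  proof (intro idl_sum idl_mult)
    fix m assume "m \<in> Poly_Mapping.keys x"
    then consider "j \<le> (\<Sum>v\<in>\<gamma> ` T. Poly_Mapping.lookup m v)" | b where "b \<in> B" "0 < Poly_Mapping.lookup m (\<gamma> b)"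
      using x unfolding monomial_vanishing_def by blast
    then show "(\<Prod>v\<in>UNIV. lin (h (axis v 1)) ^ Poly_Mapping.lookup m v)
        \<in> idl ({mon T e | e. j \<le> sum e T} \<union> lin ` B)" (is "?p \<in> _")
    proof cases
      case 1
      let ?e = "\<lambda>a. Poly_Mapping.lookup m (\<gamma> a)"
      have injT: "inj_on \<gamma> T" using inj by (rule inj_on_subset) auto
      have "?p = (\<Prod>v\<in>UNIV - \<gamma> ` T. lin (h (axis v 1)) ^ Poly_Mapping.lookup m v)
          * (\<Prod>v\<in>\<gamma> ` T. lin (h (axis v 1)) ^ Poly_Mapping.lookup m v)"
        by (rule prod.subset_diff) auto
      also have "(\<Prod>v\<in>\<gamma> ` T. lin (h (axis v 1)) ^ Poly_Mapping.lookup m v) = mon T ?e"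
        unfolding mon_def prod.reindex[OF injT] o_def by (rule prod.cong) (simp_all add: h\<gamma>)
      finally have p: "?p = (\<Prod>v\<in>UNIV - \<gamma> ` T. lin (h (axis v 1)) ^ Poly_Mapping.lookup m v) * mon T ?e" .
      have "j \<le> sum ?e T" using 1 by (simp add: sum.reindex[OF injT])
      then show ?thesis unfolding p by (blast intro: idl_mult idl_base)
    next
      case (2 b)
      have p: "?p = (\<Prod>v\<in>UNIV - {\<gamma> b}. lin (h (axis v 1)) ^ Poly_Mapping.lookup m v)
          * lin b ^ Poly_Mapping.lookup m (\<gamma> b)"
        using prod.remove[of UNIV "\<gamma> b" "\<lambda>v. lin (h (axis v 1)) ^ Poly_Mapping.lookup m v"] 2
        by (simp add: h\<gamma> mult.commute)
      have "lin b ^ Poly_Mapping.lookup m (\<gamma> b) = lin b ^ (Poly_Mapping.lookup m (\<gamma> b) - 1) * lin b"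
        using 2 by (metis One_nat_def Suc_pred power_Suc2)
      then show ?thesis
        unfolding p using 2 by (auto intro!: idl_mult intro: idl_base)
    qed
  qed
  have "poly_var (\<gamma> s) * ?\<psi> f \<in> monomial_vanishing (\<gamma> ` T) k (\<gamma> ` B)"
    using \<psi>_in[OF f] by (simp add: psubst_mult \<psi>_lin)
  moreover have "\<gamma> s \<notin> \<gamma> ` B" "\<gamma> s \<in> \<gamma> ` T \<longleftrightarrow> s \<in> T"
    using inj sB by (auto simp: inj_on_def)
  ultimately have "?\<psi> f \<in> monomial_vanishing (\<gamma> ` T) (if s \<in> T then k - 1 else k) (\<gamma> ` B)"
    using monomial_vanishing_cancel by fastforce
  then show ?thesis using \<phi>_in inv[of f] by metis
qed

section \<open>Symbolic powers along a matroid\<close>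

lemma idl_mult_image:
  "x \<in> idl G \<Longrightarrow> (\<And>g. g \<in> G \<Longrightarrow> r * g \<in> idl H) \<Longrightarrow> r * x \<in> idl H"
proof (induction x rule: idl.induct)
  case (idl_step y g q)
  then have "r * y + q * (r * g) \<in> idl H" by (blast intro: idl_add idl_mult)
  then show ?case by (simp add: algebra_simps)
qed (simp add: idl_zero)

lemma mon_remove: "finite E \<Longrightarrow> s \<in> E \<Longrightarrow> mon E e = lin s ^ e s * mon (E - {s}) e"
  unfolding mon_def by (rule prod.remove)

lemma mon_cong: "(\<And>a. a \<in> E \<Longrightarrow> e a = e' a) \<Longrightarrow> mon E e = mon E e'"
  unfolding mon_def by (rule prod.cong) auto

lemma mon_zero [simp]: "mon E (\<lambda>_. 0) = 1"
  by (simp add: mon_def)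

lemma mon_Suc:
  assumes "finite E" "s \<in> E"
  shows "lin s * mon E e = mon E (e(s := Suc (e s)))"
  using assms mon_cong[of "E - {s}" e "e(s := Suc (e s))"]
  by (simp add: mon_remove mult.assoc)

lemma mon_delete:
  assumes "finite E" "s \<in> E"
  shows "mon (E - {s}) e = mon E (e(s := 0))"
  using assms mon_cong[of "E - {s}" e "e(s := 0)"] by (simp add: mon_remove)

lemma mon_in_vanishing_ideal:
  assumes "finite E" "T \<subseteq> E" "k \<le> sum e T"
  shows "mon E e \<in> vanishing_ideal T k B"
proof -
  have "mon E e = mon (E - T) e * mon T e"
    unfolding mon_def using assms by (intro prod.subset_diff)
  then show ?thesis
    using assms unfolding vanishing_ideal_def by (auto intro!: idl_mult intro: idl_base)
qed

text \<open>A generator that involves \<open>s\<close> is a multiple of \<open>lin s\<close>, which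
  now belongs to the generators; one that does not involve \<open>s\<close> keeps its full degree on
  \<open>T - {s}\<close>. Hence the order \<open>k\<close> does not drop.\<close>

lemma vanishing_ideal_contract:
  assumes "f \<in> vanishing_ideal T k B" "finite T" "s \<in> T"
  shows "f \<in> vanishing_ideal (T - {s}) k (insert s B)"
  using assms(1) unfolding vanishing_ideal_def
proof (rule idl_least)
  fix g assume g: "g \<in> {mon T e |e. k \<le> sum e T} \<union> lin ` B"
  show "g \<in> idl ({mon (T - {s}) e |e. k \<le> sum e (T - {s})} \<union> lin ` insert s B)" (is "_ \<in> idl ?H")
  proof (cases "g \<in> lin ` B")
    case True
    then show ?thesis by (auto intro: idl_base)
  next
    case False
    then obtain e where e: "g = mon T e" "k \<le> sum e T" using g by blast
    show ?thesis
    proof (cases "e s")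
      case 0
      then have "g = mon (T - {s}) e" "k \<le> sum e (T - {s})"
        using e assms by (auto simp: mon_remove sum.remove)
      then show ?thesis by (blast intro: idl_base)
    next
      case (Suc i)
      then have "g = (lin s ^ i * mon (T - {s}) e) * lin s"
        using e assms by (simp add: mon_remove mult_ac)
      moreover have "lin s \<in> idl ?H" by (blast intro: idl_base)
      ultimately show ?thesis by (simp only: idl_mult)
    qed
  qed
qed

text \<open>
  The sets in \<open>\<T>\<close> are the bases of a matroid, the forms in \<open>B\<close> are the ones already set to zero.
  Among all forms take one, \<open>s\<close>, of minimal weight: modulo \<open>lin s\<close> the claim is the one for the
  contraction by \<open>s\<close>, and minimality of the weight together with the exchange property says that
  the monomials found there also satisfy the conditions at the bases avoiding \<open>s\<close>.  The quotient
  by \<open>lin s\<close> of what remains satisfies the hypotheses with the weight of \<open>s\<close> raised by one.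
\<close>

lemma matroid_symbolic_power:
  fixes E B :: "('k::field^'v::finite) set" and c :: "'k^'v \<Rightarrow> nat"
  assumes "finite E"
    and "\<And>T. T \<in> \<T> \<Longrightarrow> T \<subseteq> E \<and> card T = n"
    and "\<And>T s. T \<in> \<T> \<Longrightarrow> s \<in> \<Union>\<T> \<Longrightarrow> vec.independent (insert s T \<union> B)"
    and "E \<inter> B = {}"
    and "\<And>T T' s. T \<in> \<T> \<Longrightarrow> T' \<in> \<T> \<Longrightarrow> s \<in> T' - T \<Longrightarrow> \<exists>j\<in>T - T'. insert s (T - {j}) \<in> \<T>"
    and "\<And>T. T \<in> \<T> \<Longrightarrow> f \<in> vanishing_ideal T (m - sum c T) B"
  shows "f \<in> idl ({mon E e |e. \<forall>T\<in>\<T>. m \<le> sum e T + sum c T} \<union> lin ` B)"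
  using assms
\<comment> \<open>The induction is on the rank of the matroid, which contraction by \<open>s\<close>
  lowers by one.\<close>
proof (induction n arbitrary: E B \<T> m c f)
  \<comment> \<open>In rank 0 the only possible basis is empty. Its condition is void for
    \<open>m = 0\<close>, when \<open>1\<close> is an admissible monomial, and otherwise says that
    \<open>f\<close> lies in the ideal of \<open>B\<close>.\<close>
  case 0
  show ?case
  proof (cases "m = 0 \<or> \<T> = {}")
    case True
    then have "mon E (\<lambda>_. 0) \<in> {mon E e |e. \<forall>T\<in>\<T>. m \<le> sum e T + sum c T} \<union> lin ` B"
      by blast
    then show ?thesis using idl_mult[OF idl_base, of "mon E (\<lambda>_. 0)" _ f] by simp
  next
    case False
    then have "{} \<in> \<T>" using 0(1,2) by (metis card_0_eq equals0I finite_subset)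
    then have "f \<in> idl (lin ` B)" using 0(6)[of "{}"] False by (simp add: vanishing_ideal_def)
    then show ?thesis using idl_mono[of "lin ` B"] by blast
  qed
next
  case (Suc n)
  note fin = Suc.prems(1) and TE = Suc.prems(2) and ind = Suc.prems(3) and disj = Suc.prems(4)
    and exch = Suc.prems(5)
  have finT: "finite T" if "T \<in> \<T>" for T using TE[OF that] fin finite_subset by blast
  show ?case using Suc.prems(6)
  \<comment> \<open>Each round raises the weight of a form \<open>s\<close> with
    \<open>c s < m\<close>, so one truncated difference drops and the others stay.\<close>
  proof (induction "\<Sum>a\<in>E. m - c a" arbitrary: c f rule: less_induct)
    case less
    let ?M = "\<lambda>c. {mon E e |e. \<forall>T\<in>\<T>. m \<le> sum e T + sum c T}"
    show ?case
    proof (cases "\<forall>T\<in>\<T>. m \<le> sum c T")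
      case True
      then have "mon E (\<lambda>_. 0) \<in> ?M c \<union> lin ` B" by fastforce
      then show ?thesis using idl_mult[OF idl_base, of "mon E (\<lambda>_. 0)" _ f] by simp
    next
      case False
      then obtain T0 where T0: "T0 \<in> \<T>" "sum c T0 < m" by auto
      obtain j0 where j0: "j0 \<in> T0" using TE[OF T0(1)] by fastforce
      define s where "s = arg_min_on c (\<Union>\<T>)"
      have finU: "finite (\<Union>\<T>)" using TE fin by (meson Union_least finite_subset)
      have neU: "\<Union>\<T> \<noteq> {}" using T0 j0 by blast
      have sU: "s \<in> \<Union>\<T>" unfolding s_def by (rule arg_min_if_finite(1)[OF finU neU])
      have smin: "c s \<le> c j" if "j \<in> \<Union>\<T>" for j
        unfolding s_def by (rule arg_min_least[OF finU neU that])
      obtain T1 where T1: "T1 \<in> \<T>" "s \<in> T1" using sU by blast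
      have sE: "s \<in> E" using T1 TE by blast
      have sB: "s \<notin> B" using sE disj by blast
      have "c s \<le> c j0" using smin T0 j0 by blast
      also have "\<dots> \<le> sum c T0" using finT[OF T0(1)] j0 by (simp add: member_le_sum)
      finally have cs: "c s < m" using T0 by simp
      let ?\<T> = "{T - {s} |T. T \<in> \<T> \<and> s \<in> T}"
      \<comment> \<open>Contracted bases no longer contain \<open>s\<close>, so its weight is taken
        off the target order instead.\<close>
      let ?G = "{mon (E - {s}) e |e. \<forall>T\<in>?\<T>. m - c s \<le> sum e T + sum c T}"
      have "f \<in> idl (?G \<union> lin ` insert s B)"
      proof (rule Suc.IH)
        show "finite (E - {s})" using fin by simp
        show "T \<subseteq> E - {s} \<and> card T = n" if "T \<in> ?\<T>" for T
          using that TE by (fastforce simp: card_Diff_singleton)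
        show "vec.independent (insert u T \<union> insert s B)" if T: "T \<in> ?\<T>" and u: "u \<in> \<Union>?\<T>" for T u
        proof -
          obtain T' where T': "T = T' - {s}" "T' \<in> \<T>" "s \<in> T'" using T by blast
          have "u \<in> \<Union>\<T>" using u by blast
          moreover have "insert u T \<union> insert s B = insert u T' \<union> B" using T' by blast
          ultimately show ?thesis using ind T' by metis
        qed
        show "(E - {s}) \<inter> insert s B = {}" using disj by blast
        show "\<exists>j\<in>T - T'. insert u (T - {j}) \<in> ?\<T>"
          if T: "T \<in> ?\<T>" "T' \<in> ?\<T>" and u: "u \<in> T' - T" for T T' u
        proof -
          obtain S S' where S: "T = S - {s}" "S \<in> \<T>" "s \<in> S" "T' = S' - {s}" "S' \<in> \<T>" "s \<in> S'"
            using T by blast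
          then obtain j where j: "j \<in> S - S'" "insert u (S - {j}) \<in> \<T>"
            using exch[of S S' u] u by blast
          have "insert u (T - {j}) = insert u (S - {j}) - {s}" "s \<in> insert u (S - {j})" "j \<in> T - T'"
            using S j u by auto
          then show ?thesis using j by blast
        qed
        show "f \<in> vanishing_ideal T (m - c s - sum c T) (insert s B)" if T: "T \<in> ?\<T>" for T
        proof -
          from T obtain S where S: "T = S - {s}" "S \<in> \<T>" "s \<in> S" by auto
          have "sum c S = c s + sum c T"
            unfolding S(1) by (rule sum.remove[OF finT[OF S(2)] S(3)])
          then have "m - sum c S = m - c s - sum c T" by simp
          then show ?thesis
            using vanishing_ideal_contract[OF less.prems[OF S(2)] finT[OF S(2)] S(3)] S(1) by simp
        qed
      qed
      moreover have "?G \<subseteq> ?M c"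
      proof clarify
        fix e assume e: "\<forall>T\<in>?\<T>. m - c s \<le> sum e T + sum c T"
        \<comment> \<open>The value of \<open>e\<close> at \<open>s\<close> is invisible in
          \<open>mon (E - {s}) e\<close> and has to be cleared before the monomial is read over all
          of \<open>E\<close>.\<close>
        let ?e = "e(s := 0)"
        have "m \<le> sum ?e T + sum c T" if T: "T \<in> \<T>" for T
        proof (cases "s \<in> T")
          case True
          then have "m - c s \<le> sum e (T - {s}) + sum c (T - {s})" using e T by blast
          moreover have "sum ?e (T - {s}) = sum e (T - {s})" by (rule sum.cong) auto
          ultimately show ?thesis using True finT[OF T] by (simp add: sum.remove[of T s])
        next
          case False
          \<comment> \<open>Bringing \<open>s\<close> into \<open>T\<close> expels some
            \<open>j\<close>. The inequality at \<open>T - {j}\<close> has target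
            \<open>m - c s\<close>, and \<open>c s \<le> c j\<close> makes up for the difference
            once \<open>j\<close> is put back.\<close>
          then obtain j where j: "j \<in> T" "insert s (T - {j}) \<in> \<T>"
            using exch[of T T1 s] T T1 by blast
          have "T - {j} \<in> ?\<T>"
            using False j by (intro CollectI exI[of _ "insert s (T - {j})"]) auto
          then have "m - c s \<le> sum e (T - {j}) + sum c (T - {j})" by (rule bspec[OF e])
          moreover have "sum ?e T = sum e T" using False by (intro sum.cong) auto
          moreover have "c s \<le> c j" using smin T j by blast
          ultimately show ?thesis using j finT[OF T] by (simp add: sum.remove[of T j])
        qed
        then show "\<exists>e'. mon (E - {s}) e = mon E e' \<and> (\<forall>T\<in>\<T>. m \<le> sum e' T + sum c T)"
          by (intro exI[of _ ?e] conjI mon_delete[OF fin sE]) blast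
      qed
      then have "?G \<union> lin ` insert s B \<subseteq> insert (lin s) (?M c \<union> lin ` B)" by auto
      ultimately have "f \<in> idl (insert (lin s) (?M c \<union> lin ` B))"
        by (meson idl_mono subsetD)
      then obtain a r where a: "a \<in> idl (?M c \<union> lin ` B)" and far: "f = a + r * lin s"
        using idl_insert by blast
      let ?c = "c(s := Suc (c s))"
      have sum_c: "sum ?c T = (if s \<in> T then Suc (sum c T) else sum c T)" if "T \<in> \<T>" for T
      proof (cases "s \<in> T")
        case True
        have "sum ?c (T - {s}) = sum c (T - {s})" by (rule sum.cong) auto
        then show ?thesis using True finT[OF that] by (simp add: sum.remove[of T s])
      next
        case False
        then have "sum ?c T = sum c T" by (intro sum.cong) auto
        then show ?thesis using False by simp
      qed
      \<comment> \<open>Both \<open>f\<close> and \<open>a\<close> have the required order at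
        \<open>T\<close>, hence so does \<open>lin s * r\<close>. Cancelling \<open>lin s\<close>
        costs one order exactly when \<open>s \<in> T\<close>, which is what the raised weight
        allows.\<close>
      have "r \<in> vanishing_ideal T (m - sum ?c T) B" if T: "T \<in> \<T>" for T
      proof -
        have "a \<in> vanishing_ideal T (m - sum c T) B"
          using a unfolding vanishing_ideal_def
        proof (rule idl_least)
          fix g assume "g \<in> ?M c \<union> lin ` B"
          then consider "g \<in> lin ` B" | e where "g = mon E e" "\<forall>T\<in>\<T>. m \<le> sum e T + sum c T" by blast
          then show "g \<in> idl ({mon T e |e. m - sum c T \<le> sum e T} \<union> lin ` B)"
          proof cases
            case 1
            then show ?thesis by (simp add: idl_base)
          next
            case (2 e)
            then have "m - sum c T \<le> sum e T" using T by (simp add: le_diff_conv)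
            then show ?thesis
              using mon_in_vanishing_ideal[OF fin, of T] TE[OF T] 2(1) unfolding vanishing_ideal_def by blast
          qed
        qed
        then have *: "lin s * r \<in> vanishing_ideal T (m - sum c T) B"
          using less.prems[OF T] idl_diff[of f _ a] far
          unfolding vanishing_ideal_def by (simp add: mult.commute)
        have "m - sum ?c T = (if s \<in> T then m - sum c T - 1 else m - sum c T)"
          unfolding sum_c[OF T] by simp
        then show ?thesis
          using vanishing_ideal_cancel[OF ind[OF T sU] sB *] by (simp only:)
      qed
      moreover have "(\<Sum>a\<in>E. m - ?c a) < (\<Sum>a\<in>E. m - c a)"
        using fin sE cs by (intro sum_strict_mono_ex1) auto
      ultimately have r: "r \<in> idl (?M ?c \<union> lin ` B)" using less.hyps by blast
      \<comment> \<open>Multiplying back by \<open>lin s\<close> moves the extra unit at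
        \<open>s\<close> from the weight into the exponent.\<close>
      have "lin s * r \<in> idl (?M c \<union> lin ` B)"
        using r
      proof (rule idl_mult_image)
        fix g assume "g \<in> ?M ?c \<union> lin ` B"
        then consider "g \<in> lin ` B" | e where "g = mon E e" "\<forall>T\<in>\<T>. m \<le> sum e T + sum ?c T" by blast
        then show "lin s * g \<in> idl (?M c \<union> lin ` B)"
        proof cases
          case 1
          then show ?thesis by (simp add: idl_base idl_mult)
        next
          case (2 e)
          let ?e = "e(s := Suc (e s))"
          have "m \<le> sum ?e T + sum c T" if T: "T \<in> \<T>" for T
          proof (cases "s \<in> T")
            case True
            have "sum ?e (T - {s}) = sum e (T - {s})" by (rule sum.cong) auto
            then have "sum ?e T = Suc (sum e T)" using True finT[OF T] by (simp add: sum.remove[of T s])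
            then show ?thesis using 2(2) T sum_c[OF T] True by fastforce
          next
            case False
            then have "sum ?e T = sum e T" by (intro sum.cong) auto
            then show ?thesis using 2(2) T sum_c[OF T] False by fastforce
          qed
          then have "mon E ?e \<in> ?M c \<union> lin ` B" by blast
          then show ?thesis unfolding 2(1) mon_Suc[OF fin sE] by (rule idl_base)
        qed
      qed
      then show ?thesis unfolding far using a by (simp add: idl_add mult.commute)
    qed
  qed
qed

section \<open>Forms and their values\<close>

definition dot :: "'k^'v \<Rightarrow> 'k^'v \<Rightarrow> 'k::comm_ring_1" where
  "dot a x = (\<Sum>v\<in>UNIV. a $ v * x $ v)"

lemma dot_commute: "dot a x = dot x a"
  by (simp add: dot_def mult.commute)

lemma dot_add: "dot a (x + y) = dot a x + dot a y"
  by (simp add: dot_def algebra_simps sum.distrib)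

lemma dot_diff: "dot a (x - y) = dot a x - dot a y"
  by (simp add: dot_def algebra_simps sum_subtractf)

lemma dot_scale: "dot a (c *s x) = c * dot a x"
  by (simp add: dot_def algebra_simps sum_distrib_left)

lemma dot_zero [simp]: "dot a 0 = 0"
  by (simp add: dot_def)

lemma dot_axis [simp]: "dot (axis v 1) x = x $ v"
  by (simp add: dot_def axis_def if_distrib[of "\<lambda>c. c * _"] cong: if_cong)

lemma dot_span: "x \<in> vec.span S \<Longrightarrow> (\<And>y. y \<in> S \<Longrightarrow> dot a y = 0) \<Longrightarrow> dot a x = 0"
  by (induction x rule: vec.span_induct_alt) (auto simp: dot_add dot_scale)

section \<open>Evaluation and homogeneity in terms of substitution\<close>

lemma const_mult:
  "Poly_Mapping.single 0 (c * d) = (Poly_Mapping.single 0 c * Poly_Mapping.single 0 d :: ('k::field, 'v::finite) mpoly)"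
  by (simp add: mult_single)

lemma const_sum:
  "Poly_Mapping.single 0 (\<Sum>i\<in>I. f i) = (\<Sum>i\<in>I. Poly_Mapping.single 0 (f i) :: ('k::field, 'v::finite) mpoly)"
  by (induction I rule: infinite_finite_induct) (auto simp: single_add)

lemma const_prod:
  "Poly_Mapping.single 0 (\<Prod>i\<in>I. f i) = (\<Prod>i\<in>I. Poly_Mapping.single 0 (f i) :: ('k::field, 'v::finite) mpoly)"
  by (induction I rule: infinite_finite_induct) (auto simp: const_mult)

lemma const_power:
  "Poly_Mapping.single 0 (c ^ n) = (Poly_Mapping.single 0 c ^ n :: ('k::field, 'v::finite) mpoly)"
  by (induction n) (auto simp: const_mult)

text \<open>Evaluation is substitution of constants, so the multiplicativity of
  \<open>poly_eval\<close> comes from that of \<open>psubst\<close>.\<close>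

lemma psubst_point:
  "psubst (\<lambda>v. Poly_Mapping.single 0 (x $ v)) f = Poly_Mapping.single 0 (poly_eval x f)"
  by (simp add: psubst_def poly_eval_def const_sum const_mult const_prod const_power)

lemma poly_eval_mult: "poly_eval x (f * g) = poly_eval x f * poly_eval x g"
proof -
  have "Poly_Mapping.single 0 (poly_eval x (f * g))
      = (Poly_Mapping.single 0 (poly_eval x f * poly_eval x g) :: ('a, 'b) mpoly)"
    by (simp add: psubst_mult const_mult flip: psubst_point)
  then show ?thesis by (metis lookup_single_eq)
qed

lemma poly_eval_lin: "poly_eval x (lin a) = dot a x"
proof -
  have "Poly_Mapping.single 0 (poly_eval x (lin a)) = (Poly_Mapping.single 0 (dot a x) :: ('a, 'b) mpoly)"
    unfolding psubst_point[symmetric]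
    by (simp add: lin_def psubst_sum psubst_mult dot_def const_sum const_mult)
  then show ?thesis by (metis lookup_single_eq)
qed

lemma poly_eval_prod: "finite I \<Longrightarrow> i \<in> I \<Longrightarrow> poly_eval x (f i) = 0 \<Longrightarrow> poly_eval x (\<Prod>i\<in>I. f i) = 0"
  by (simp add: prod.remove poly_eval_mult)

lemma is_form_mult:
  fixes f g :: "('k::field, 'v::finite) mpoly"
  assumes "is_form f" "is_form g"
  shows "is_form (f * g)"
proof -
  obtain i where i: "\<forall>m\<in>Poly_Mapping.keys f. (\<Sum>v\<in>UNIV. Poly_Mapping.lookup m v) = i"
    using assms(1) unfolding is_form_def by blast
  obtain j where j: "\<forall>m\<in>Poly_Mapping.keys g. (\<Sum>v\<in>UNIV. Poly_Mapping.lookup m v) = j"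
    using assms(2) unfolding is_form_def by blast
  have "(\<Sum>v\<in>UNIV. Poly_Mapping.lookup m v) = i + j" if m: "m \<in> Poly_Mapping.keys (f * g)" for m
  proof -
    obtain a b where "m = a + b" "a \<in> Poly_Mapping.keys f" "b \<in> Poly_Mapping.keys g"
      using keys_mult[of f g] m by blast
    then show ?thesis using i j by (simp add: lookup_add sum.distrib)
  qed
  then show ?thesis unfolding is_form_def by blast
qed

lemma is_form_lin: "is_form (lin a :: ('k::field, 'v::finite) mpoly)"
  unfolding is_form_def
proof (intro exI[of _ 1] ballI)
  fix m assume "m \<in> Poly_Mapping.keys (lin a :: ('k, 'v) mpoly)"
  then obtain v where "Poly_Mapping.lookup (Poly_Mapping.single 0 (a $ v) * poly_var v :: ('k, 'v) mpoly) m \<noteq> 0"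
    unfolding lin_def in_keys_iff lookup_sum by (meson sum.not_neutral_contains_not_neutral)
  then have "m = Poly_Mapping.single v 1"
    by (auto simp: poly_var_def mult_single lookup_single when_def split: if_splits)
  then show "(\<Sum>v\<in>UNIV. Poly_Mapping.lookup m v) = 1"
    by (simp add: lookup_single when_def)
qed

lemma is_form_prod: "(\<And>i. i \<in> I \<Longrightarrow> is_form (f i)) \<Longrightarrow> is_form (\<Prod>i\<in>I. f i)"
proof (induction I rule: infinite_finite_induct)
  case (insert i I)
  then show ?case by (simp add: is_form_mult)
qed (simp_all add: is_form_def)

text \<open>By homogeneity the substitution gives the value of \<open>f\<close> at \<open>p\<close>
  times a power of \<open>lin w\<close>.\<close>

lemma form_on_line:
  fixes w p :: "'k::field^'v::finite"
  assumes "is_form f" "poly_eval p f = 0"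
  shows "psubst (\<lambda>v. Poly_Mapping.single 0 (p $ v) * lin w) f = 0"
proof -
  obtain n where n: "\<forall>m\<in>Poly_Mapping.keys f. (\<Sum>v\<in>UNIV. Poly_Mapping.lookup m v) = n"
    using assms(1) unfolding is_form_def by blast
  have "psubst (\<lambda>v. Poly_Mapping.single 0 (p $ v) * lin w) f
      = psubst (\<lambda>v. Poly_Mapping.single 0 (p $ v)) f * lin w ^ n"
    unfolding psubst_def sum_distrib_right
    using n by (intro sum.cong) (auto simp: power_mult_distrib prod.distrib mult.assoc simp flip: power_sum)
  then show ?thesis by (simp add: psubst_point assms(2))
qed

text \<open>
  Modulo the linear forms vanishing at \<open>p\<close>, a form is congruent to its restriction to the line
  through \<open>p\<close>, written in the coordinate \<open>w\<close>.
\<close>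

lemma form_in_linear_ideal:
  fixes w p :: "'k::field^'v::finite"
  assumes f: "is_form f" "poly_eval p f = 0" and w: "dot w p = 1"
    and S: "\<And>a. dot a p = 0 \<Longrightarrow> a \<in> vec.span S"
  shows "f \<in> idl (lin ` S)"
proof -
  let ?\<sigma> = "psubst (\<lambda>v. Poly_Mapping.single 0 (p $ v) * lin w)"
  \<comment> \<open>Shown for all polynomials, so that induction over sums and products is possible.
    On a variable, \<open>dot w p = 1\<close> makes the difference a linear form vanishing at
    \<open>p\<close>.\<close>
  have "g - ?\<sigma> g \<in> idl (lin ` S)" for g
  proof (induction g rule: mpoly_induct)
    case (const c)
    then show ?case by (simp add: idl_zero)
  next
    case (var v)
    have "poly_var v - ?\<sigma> (poly_var v) = lin (axis v 1 - (p $ v) *s w)"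
      using lin_add[of "axis v 1 - (p $ v) *s w" "(p $ v) *s w"]
      unfolding psubst_var lin_scale diff_add_cancel lin_axis eq_diff_eq[symmetric] by simp
    moreover have "dot (axis v 1 - (p $ v) *s w) p = 0"
      using w by (simp add: dot_commute[of _ p] dot_diff dot_scale) (simp add: dot_commute[of p])
    ultimately show ?case using lin_span[OF S] by simp
  next
    case (add g h)
    have "g + h - ?\<sigma> (g + h) = (g - ?\<sigma> g) + (h - ?\<sigma> h)" by (simp add: psubst_add)
    then show ?case using add by (simp only: idl_add)
  next
    case (mult g h)
    have "g * h - ?\<sigma> (g * h) = g * (h - ?\<sigma> h) + ?\<sigma> h * (g - ?\<sigma> g)"
      by (simp add: psubst_mult algebra_simps)
    then show ?case using mult by (simp only: idl_add idl_mult)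
  qed
  from this[of f] show ?thesis using form_on_line[OF f, of w] by simp
qed

section \<open>Ideals of the coordinate ring\<close>

lemma ideal_closed:
  assumes "ideal J (ring_of_type_algebra :: 'a::comm_ring_1 ring)"
  shows "0 \<in> J" "x \<in> J \<Longrightarrow> y \<in> J \<Longrightarrow> x + y \<in> J" "x \<in> J \<Longrightarrow> r * x \<in> J"
proof -
  interpret ideal J "ring_of_type_algebra :: 'a ring" by fact
  show "0 \<in> J" using additive_subgroup.zero_closed[OF ideal.axioms(1)[OF assms]] by (simp add: ring_of_type_algebra_def)
  show "x \<in> J \<Longrightarrow> y \<in> J \<Longrightarrow> x + y \<in> J" using additive_subgroup.a_closed[OF ideal.axioms(1)[OF assms], of x y] by (simp add: ring_of_type_algebra_def)
  show "x \<in> J \<Longrightarrow> r * x \<in> J" using I_l_closed by (simp add: ring_of_type_algebra_def)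
qed

lemma idl_subset_ideal:
  assumes "ideal J (ring_of_type_algebra :: 'a::comm_ring_1 ring)" "G \<subseteq> J"
  shows "idl G \<subseteq> J"
proof
  fix x assume "x \<in> idl G"
  then show "x \<in> J"
    by (induction x rule: idl.induct) (use assms ideal_closed in blast)+
qed

lemma ideal_idl: "ideal (idl G) (ring_of_type_algebra :: 'a::comm_ring_1 ring)"
proof (rule idealI)
  show "ring (ring_of_type_algebra :: 'a ring)" by (rule ring_from_type_algebra)
  show "subgroup (idl G) (add_monoid (ring_of_type_algebra :: 'a ring))"
  proof (rule group.subgroupI)
    show "group (add_monoid (ring_of_type_algebra :: 'a ring))"
      using ring_from_type_algebra ring.is_abelian_group abelian_group.a_group by blast
    show "inv\<^bsub>add_monoid (ring_of_type_algebra :: 'a ring)\<^esub> a \<in> idl G" if "a \<in> idl G" for a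
    proof -
      interpret group "add_monoid (ring_of_type_algebra :: 'a ring)"
        using ring_from_type_algebra ring.is_abelian_group abelian_group.a_group by blast
      have "inv\<^bsub>add_monoid (ring_of_type_algebra :: 'a ring)\<^esub> a = - 1 * a"
        by (rule inv_equality) (simp_all add: ring_of_type_algebra_def)
      then show ?thesis using idl_mult[OF that, of "- 1"] by simp
    qed
    show "idl G \<noteq> {}" using idl_zero by blast
  qed (auto simp: ring_of_type_algebra_def idl_add)
qed (use idl_mult in \<open>auto simp: ring_of_type_algebra_def mult.commute\<close>)

text \<open>Connects the ideals of the problem with the inductive \<open>idl\<close>, whose
  induction rule carries the arguments on generators.\<close>

lemma genideal_eq_idl:
  "Idl\<^bsub>(ring_of_type_algebra :: 'a::comm_ring_1 ring)\<^esub> G = idl G"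
proof
  interpret ring "ring_of_type_algebra :: 'a ring" by (rule ring_from_type_algebra)
  have G: "G \<subseteq> carrier (ring_of_type_algebra :: 'a ring)" by (simp add: ring_of_type_algebra_def)
  show "Idl\<^bsub>(ring_of_type_algebra :: 'a ring)\<^esub> G \<subseteq> idl G"
    by (rule genideal_minimal[OF ideal_idl]) (auto intro: idl_base)
  show "idl G \<subseteq> Idl\<^bsub>(ring_of_type_algebra :: 'a ring)\<^esub> G"
    by (rule idl_subset_ideal[OF genideal_ideal[OF G] genideal_self[OF G]])
qed

lemma ideal_mult_mem:
  "a \<in> I \<Longrightarrow> b \<in> I' \<Longrightarrow> a * b \<in> ideal_mult I (I' :: ('k::field, 'v::finite) mpoly set)"
  using ideal_prod.prod[of a I b I' coord_ring] by (simp add: ideals_set_def ring_of_type_algebra_def)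

context
  fixes J :: "('k::field, 'v::finite) mpoly set"
  assumes J: "ideal J coord_ring"
begin

lemma ideal_pow_Suc: "ideal_pow J (Suc n) = ideal_mult (ideal_pow J n) J"
  by (rule nat_pow_Suc)

lemma ideal_pow_0: "ideal_pow J 0 = UNIV"
  by (simp add: ideals_set_def ring_of_type_algebra_def)

lemma ideal_ideal_pow: "ideal (ideal_pow J n) coord_ring"
proof -
  interpret cring "coord_ring :: ('k, 'v) mpoly ring" by (rule cring_from_type_algebra)
  interpret monoid "ideals_set (coord_ring :: ('k, 'v) mpoly ring)"
    using ideals_set_is_comm_monoid comm_monoid.axioms(1) by blast
  show ?thesis using nat_pow_closed[of J n] J by (simp add: ideals_set_def)
qed

lemma ideal_pow_add: "ideal_pow J (m + n) = ideal_mult (ideal_pow J m) (ideal_pow J n)"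
proof -
  interpret cring "coord_ring :: ('k, 'v) mpoly ring" by (rule cring_from_type_algebra)
  interpret monoid "ideals_set (coord_ring :: ('k, 'v) mpoly ring)"
    using ideals_set_is_comm_monoid comm_monoid.axioms(1) by blast
  show ?thesis using nat_pow_mult[of J m n] J by (simp add: ideals_set_def)
qed

lemma ideal_pow_mult: "a \<in> ideal_pow J m \<Longrightarrow> b \<in> ideal_pow J n \<Longrightarrow> a * b \<in> ideal_pow J (m + n)"
  unfolding ideal_pow_add by (rule ideal_mult_mem)

lemma ideal_pow_mem: "a \<in> J \<Longrightarrow> a ^ n \<in> ideal_pow J n"
proof (induction n)
  case 0
  then show ?case by (simp only: ideal_pow_0 UNIV_I)
next
  case (Suc n)
  then show ?case unfolding ideal_pow_Suc power_Suc2 by (intro ideal_mult_mem) auto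
qed

lemma ideal_pow_antimono:
  assumes "k \<le> n"
  shows "ideal_pow J n \<subseteq> ideal_pow J k"
proof -
  interpret ring "coord_ring :: ('k, 'v) mpoly ring" by (rule ring_from_type_algebra)
  have "ideal_pow J (k + (n - k)) \<subseteq> ideal_pow J k"
    unfolding ideal_pow_add using ideal_prod_inter[OF ideal_ideal_pow ideal_ideal_pow]
    by (simp add: ideals_set_def)
  then show ?thesis using assms by simp
qed

lemma mon_in_ideal_pow:
  assumes "finite E" "\<And>a. a \<in> E \<Longrightarrow> lin a \<in> J" "k \<le> sum e E"
  shows "mon E e \<in> ideal_pow J k"
proof -
  have "mon E e \<in> ideal_pow J (sum e E)"
    using assms(1,2) unfolding mon_def
  proof (induction E)
    case empty
    then show ?case using ideal_pow_0 by simp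
  next
    case (insert a E)
    then show ?case using ideal_pow_mult ideal_pow_mem by simp
  qed
  then show ?thesis using ideal_pow_antimono[OF assms(3)] by blast
qed

text \<open>Each further factor from \<open>J\<close> raises one exponent on \<open>T\<close>. With
  \<open>J\<close> the ideal of a point, this feeds a symbolic power into the hypotheses of
  \<open>matroid_symbolic_power\<close>.\<close>

lemma ideal_pow_subset_vanishing_ideal:
  assumes "finite T" "J \<subseteq> idl (lin ` T)"
  shows "ideal_pow J k \<subseteq> vanishing_ideal T k {}"
proof (induction k)
  case 0
  have "mon T (\<lambda>_. 0) \<in> {mon T e | e. 0 \<le> sum e T} \<union> lin ` {}" by blast
  then have "x \<in> vanishing_ideal T 0 {}" for x
    using idl_mult[OF idl_base, of "mon T (\<lambda>_. 0)" _ x] unfolding vanishing_ideal_def by simp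
  then show ?case by blast
next
  case (Suc k)
  have prods: "i * j \<in> vanishing_ideal T (Suc k) {}" if i: "i \<in> vanishing_ideal T k {}" and j: "j \<in> J" for i j
  proof -
    have "j \<in> idl (lin ` T)" using j assms(2) by blast
    then have "i * j \<in> vanishing_ideal T (Suc k) {}"
      unfolding vanishing_ideal_def
    proof (rule idl_mult_image)
      fix g assume "g \<in> lin ` T"
      then obtain a where a: "g = lin a" "a \<in> T" by blast
      have "g * i \<in> idl ({mon T e |e. Suc k \<le> sum e T} \<union> lin ` {})"
        using i unfolding vanishing_ideal_def
      proof (rule idl_mult_image)
        fix h assume "h \<in> {mon T e |e. k \<le> sum e T} \<union> lin ` {}"
        then obtain e where e: "h = mon T e" "k \<le> sum e T" by blast
        let ?e = "e(a := Suc (e a))"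
        have "sum ?e (T - {a}) = sum e (T - {a})" by (rule sum.cong) auto
        then have "sum ?e T = Suc (sum e T)" using assms(1) a by (simp add: sum.remove[of T a])
        then have "Suc k \<le> sum ?e T" using e by simp
        then show "g * h \<in> idl ({mon T e |e. Suc k \<le> sum e T} \<union> lin ` {})"
          unfolding a e mon_Suc[OF assms(1) a(2)] by (intro idl_base) blast
      qed
      then show "i * g \<in> idl ({mon T e |e. Suc k \<le> sum e T} \<union> lin ` {})"
        by (simp add: mult.commute)
    qed
    then show ?thesis .
  qed
  show ?case
  proof
    fix x assume "x \<in> ideal_pow J (Suc k)"
    then have "x \<in> ideal_prod coord_ring (ideal_pow J k) J"
      unfolding ideal_pow_Suc by (simp add: ideals_set_def)
    then show "x \<in> vanishing_ideal T (Suc k) {}"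
    proof (induction x rule: ideal_prod.induct)
      case (prod i j)
      then show ?case using prods Suc by (auto simp: ring_of_type_algebra_def)
    next
      case (sum s t)
      then show ?case unfolding vanishing_ideal_def by (simp add: ring_of_type_algebra_def idl_add)
    qed
  qed
qed

end

section \<open>The forms of a star configuration\<close>

lemma separating_functional:
  fixes S :: "('k::field^'v::finite) set"
  assumes "w \<notin> vec.span S"
  shows "\<exists>a. (\<forall>x\<in>S. dot a x = 0) \<and> dot a w = 1"
proof -
  obtain C where C: "C \<subseteq> S" "vec.independent C" "S \<subseteq> vec.span C"
    using vec.maximal_independent_subset[of S] by blast
  have w: "w \<notin> vec.span C" using C(1) assms vec.span_mono by blast
  then have "vec.independent (insert w C)" using C(2) by (rule vec.independent_insertI)
  then obtain g :: "'k^'v \<Rightarrow> 'k^'v" where g: "Vector_Spaces.linear (*s) (*s) g"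
      "\<forall>x\<in>insert w C. g x = (if x = w then 1 else 0)"
    using vec.linear_independent_extend[of "insert w C" "\<lambda>x. if x = w then 1 else 0"] by blast
  \<comment> \<open>The map \<open>g\<close> sends \<open>w\<close> to the vector with all entries
    1, so any fixed coordinate makes it a functional with value 1 at \<open>w\<close>.\<close>
  define i :: 'v where "i = undefined"
  define a where "a = (\<chi> v. g (axis v 1) $ i)"
  have a: "dot a x = g x $ i" for x
    using linear_componentwise[OF g(1), of x i] by (simp add: dot_def a_def mult.commute)
  have "dot a x = 0" if "x \<in> C" for x
  proof -
    have "x \<noteq> w" using w that vec.span_base by blast
    then show ?thesis using g(2) that by (simp add: a)
  qed
  then have "dot a x = 0" if "x \<in> S" for x
    using dot_span[of x C a] C(3) that by blast
  moreover have "dot a w = 1" using g(2) by (simp add: a)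
  ultimately show ?thesis by blast
qed

text \<open>Double annihilator: \<open>dot\<close> is symmetric, so a functional separating
  \<open>a\<close> from the span of \<open>S\<close> is also a point where \<open>S\<close> vanishes
  and \<open>a\<close> does not.\<close>

lemma span_if_annihilated:
  fixes S :: "('k::field^'v::finite) set"
  assumes "\<And>x. (\<forall>b\<in>S. dot b x = 0) \<Longrightarrow> dot a x = 0"
  shows "a \<in> vec.span S"
proof (rule ccontr)
  assume "a \<notin> vec.span S"
  then obtain x where "\<forall>b\<in>S. dot x b = 0" "dot x a = 1" using separating_functional by blast
  then show False using assms[of x] by (simp add: dot_commute[of _ x])
qed

text \<open>Induction on the codimension: \<open>W\<close> is enlarged by one vector
  \<open>w\<close>, and a functional that kills \<open>W\<close> but not \<open>w\<close> cuts it
  back. An upper bound for \<open>card Y\<close> is recorded, as independence later follows from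
  spanning with few enough forms.\<close>

lemma subspace_equations:
  fixes W :: "('k::field^'v::finite) set"
  assumes "vec.subspace W"
  shows "\<exists>Y. finite Y \<and> card Y + vec.dim W \<le> CARD('v) \<and> W = {x. \<forall>a\<in>Y. dot a x = 0}"
  using assms
proof (induction "CARD('v) - vec.dim W" arbitrary: W rule: less_induct)
  case less
  have dim_UNIV: "vec.dim (UNIV :: ('k^'v) set) = CARD('v)"
    by (simp add: vec.dim_UNIV card_cart_basis)
  then have le: "vec.dim V \<le> CARD('v)" for V :: "('k^'v) set"
    using vec.dim_subset[of V UNIV] by simp
  show ?case
  proof (cases "W = UNIV")
    case True
    then show ?thesis using dim_UNIV by (intro exI[of _ "{}"]) simp
  next
    case False
    then obtain w where w: "w \<notin> W" by blast
    have span: "vec.span W = W" using less.prems by (rule vec.span_eq_iff[THEN iffD2])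
    let ?V = "vec.span (insert w W)"
    have "w \<notin> vec.span W" using w by (subst span)
    then have dim: "vec.dim ?V = vec.dim W + 1" by (simp add: vec.dim_insert)
    then obtain Y where Y: "finite Y" "card Y + vec.dim ?V \<le> CARD('v)" "?V = {x. \<forall>a\<in>Y. dot a x = 0}"
      using less.hyps[of ?V] le[of ?V] by fastforce
    obtain a where a: "\<forall>x\<in>W. dot a x = 0" "dot a w = 1"
      using separating_functional[of w W] w span by blast
    have "x \<in> W" if "\<forall>b\<in>insert a Y. dot b x = 0" for x
    proof -
      have "x \<in> ?V" using that Y(3) by blast
      then obtain k where k: "x - k *s w \<in> W" using vec.span_breakdown_eq span by blast
      have "dot a x = dot a (x - k *s w) + k * dot a w" by (simp add: dot_diff dot_scale)
      then have "k = 0" using a k that by simp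
      then show ?thesis using k by simp
    qed
    moreover have "\<forall>b\<in>insert a Y. dot b x = 0" if "x \<in> W" for x
    proof -
      have "x \<in> ?V" using that by (simp add: vec.span_base)
      then show ?thesis using that a(1) Y(3) by blast
    qed
    moreover have "card (insert a Y) + vec.dim W \<le> CARD('v)"
      using Y(2) dim card_insert_le_m1[of "Suc (card Y)" Y a] by simp
    ultimately show ?thesis using Y(1) by (intro exI[of _ "insert a Y"]) blast
  qed
qed

text \<open>Independence is obtained by duality. The common zeros of \<open>Y\<close> and
  \<open>N\<close> hyperplane forms make up one line, and one more form \<open>w\<close> removes it;
  with \<open>N + 1\<close> hyperplane forms only the origin is left. In both cases the forms span
  the dual space and number at most its dimension.\<close>

lemma star_configuration_forms:
  fixes W :: "('k::field^'v::finite) set"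
  assumes star: "star_configuration N W Z" and N: "1 \<le> N"
  obtains Y A :: "('k^'v) set" where "finite Y" "finite A" "Y \<inter> A = {}" "N \<le> card A"
    "\<And>T. T \<subseteq> A \<Longrightarrow> card T = N \<Longrightarrow> \<exists>P\<in>Z. point_ideal P \<subseteq> idl (lin ` (Y \<union> T))"
    "\<And>T. T \<subseteq> A \<Longrightarrow> card T = N \<or> card T = N + 1 \<Longrightarrow> vec.independent (Y \<union> T)"
    "\<And>P. P \<in> Z \<Longrightarrow> \<exists>T\<subseteq>A. card T = N \<and> (\<forall>a\<in>Y \<union> T. \<forall>x\<in>P. dot a x = 0)"
proof -
  have W: "vec.subspace W" "vec.dim W = N + 1"
    using star by (auto simp: star_configuration_def proj_subspace_def)
  from star[unfolded star_configuration_def, THEN conjunct2] obtain \<H> where *: "finite \<H> \<and> N \<le> card \<H> \<and>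
      (\<forall>H\<in>\<H>. proj_hyperplane_of W H) \<and>
      (\<forall>T. T \<subseteq> \<H> \<and> card T = N \<longrightarrow> (\<exists>P. (\<Inter>H\<in>T. proj_points H) = {P})) \<and>
      (\<forall>T. T \<subseteq> \<H> \<and> card T = N + 1 \<longrightarrow> (\<Inter>H\<in>T. proj_points H) = {}) \<and>
      Z = (\<Union>T\<in>{T. T \<subseteq> \<H> \<and> card T = N}. \<Inter>H\<in>T. proj_points H)" ..
  then have \<H>: "finite \<H>" "N \<le> card \<H>" "\<And>H. H \<in> \<H> \<Longrightarrow> proj_hyperplane_of W H"
    and meet: "\<And>T. T \<subseteq> \<H> \<Longrightarrow> card T = N \<Longrightarrow> \<exists>P. (\<Inter>H\<in>T. proj_points H) = {P}"
    and nomeet: "\<And>T. T \<subseteq> \<H> \<Longrightarrow> card T = N + 1 \<Longrightarrow> (\<Inter>H\<in>T. proj_points H) = {}"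
    and Z: "Z = (\<Union>T\<in>{T. T \<subseteq> \<H> \<and> card T = N}. \<Inter>H\<in>T. proj_points H)"
    by simp_all
  obtain Y where Y: "finite Y" "card Y + vec.dim W \<le> CARD('v)" "W = {x. \<forall>a\<in>Y. dot a x = 0}"
    using subspace_equations[OF W(1)] by blast
  have sub: "vec.subspace H" if "H \<in> \<H>" for H
    using \<H>(3)[OF that] by (simp add: proj_hyperplane_of_def)
  \<comment> \<open>A functional killing \<open>H\<close> but not some \<open>w \<in> W\<close> cuts
    out exactly \<open>H\<close> in \<open>W\<close> by dimension. The witness in \<open>W\<close>
    is kept because it shows that the form is not in \<open>Y\<close>.\<close>
  have "\<exists>a. (\<forall>x. x \<in> H \<longleftrightarrow> x \<in> W \<and> dot a x = 0) \<and> (\<exists>w\<in>W. dot a w = 1)" if "H \<in> \<H>" for H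
  proof -
    have H: "vec.subspace H" "H \<subseteq> W" "vec.dim H + 1 = vec.dim W"
      using \<H>(3)[OF that] by (auto simp: proj_hyperplane_of_def)
    then obtain w where w: "w \<in> W" "w \<notin> H" by (metis Suc_eq_plus1 n_not_Suc_n subsetI subset_antisym)
    have "vec.span H = H" using H(1) by (rule vec.span_eq_iff[THEN iffD2])
    then obtain a where a: "\<forall>x\<in>H. dot a x = 0" "dot a w = 1"
      using separating_functional[of w H] w by blast
    let ?K = "{x\<in>W. dot a x = 0}"
    have K: "vec.subspace ?K"
      using W(1) unfolding vec.subspace_def by (auto simp: dot_add dot_scale)
    have "w \<notin> vec.span ?K"
    proof
      assume "w \<in> vec.span ?K"
      then have "dot a w = 0" by (rule dot_span) simp
      then show False using a(2) by simp
    qed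
    then have "vec.dim (insert w ?K) = vec.dim ?K + 1" by (simp add: vec.dim_insert)
    moreover have "vec.dim (insert w ?K) \<le> vec.dim W" using w by (intro vec.dim_subset) auto
    ultimately have "vec.dim ?K \<le> vec.dim H" using H(3) by linarith
    then have "H = ?K"
      using H(2) a(1) by (intro vec.subspace_dim_equal[OF H(1) K]) auto
    then have "x \<in> H \<longleftrightarrow> x \<in> W \<and> dot a x = 0" for x by blast
    then show ?thesis using a(2) w(1) by blast
  qed
  then obtain a where a: "\<And>H x. H \<in> \<H> \<Longrightarrow> x \<in> H \<longleftrightarrow> x \<in> W \<and> dot (a H) x = 0"
    "\<And>H. H \<in> \<H> \<Longrightarrow> \<exists>w\<in>W. dot (a H) w = 1"
    by metis
  have inj: "inj_on a \<H>"
  proof (rule inj_onI)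
    fix H H' assume "H \<in> \<H>" "H' \<in> \<H>" "a H = a H'"
    then have "x \<in> H \<longleftrightarrow> x \<in> H'" for x by (simp add: a(1))
    then show "H = H'" by blast
  qed
  let ?A = "a ` \<H>"
  have "Y \<inter> ?A = {}"
  proof (rule ccontr)
    assume "Y \<inter> ?A \<noteq> {}"
    then obtain H where H: "H \<in> \<H>" "a H \<in> Y" by blast
    then obtain w where "w \<in> W" "dot (a H) w = 1" using a(2) by blast
    then show False using H(2) Y(3) by auto
  qed
  \<comment> \<open>For empty \<open>S\<close> the right side would be void while the left still
    requires \<open>x \<in> W\<close>; here \<open>1 \<le> N\<close> enters.\<close>
  have cut: "(\<forall>b\<in>Y \<union> a ` S. dot b x = 0) \<longleftrightarrow> (\<forall>H\<in>S. x \<in> H)" if "S \<subseteq> \<H>" "S \<noteq> {}" for S x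
    using that a(1) Y(3) by blast
  have line: "vec.span {x} \<in> (\<Inter>H\<in>S. proj_points H)" if "S \<subseteq> \<H>" "\<forall>H\<in>S. x \<in> H" "x \<noteq> 0" for S x
  proof
    fix H assume "H \<in> S"
    then have "vec.span {x} \<subseteq> H" using that sub by (intro vec.span_minimal) auto
    then show "vec.span {x} \<in> proj_points H"
      using that(3) by (simp add: proj_points_def vec.subspace_span)
  qed
  have small: "card (Y \<union> a ` S) \<le> CARD('v) - (N + 1) + card S" if "S \<subseteq> \<H>" for S
    using card_Un_le[of Y "a ` S"] card_image_le[of S a] finite_subset[OF that \<H>(1)] Y(2) W(2) by linarith
  have spanning_independent: "vec.independent U"
    if "\<And>x. (\<forall>b\<in>U. dot b x = 0) \<Longrightarrow> x = 0" "finite U" "card U \<le> CARD('v)" for U :: "('k^'v) set"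
  proof (rule vec.card_le_dim_spanning[of U UNIV])
    show "UNIV \<subseteq> vec.span U" using that(1) span_if_annihilated[of U] by fastforce
    show "card U \<le> vec.dim (UNIV :: ('k^'v) set)"
      using that(3) by (simp add: vec.dim_UNIV card_cart_basis)
  qed (use that(2) in auto)
  have NV: "N + 1 \<le> CARD('v)" using Y(2) W(2) by simp
  \<comment> \<open>A nonzero common zero of the forms spans a projective point lying on all
    hyperplanes of \<open>S\<close>, hence the unique one, \<open>P\<close>; so every common zero is
    a multiple of \<open>p\<close>.\<close>
  have point: "\<exists>P\<in>Z. \<exists>p w. p \<in> P \<and> dot w p = 1 \<and>
      (\<forall>x. (\<forall>b\<in>Y \<union> a ` S. dot b x = 0) \<longrightarrow> (\<exists>c. x = c *s p))"
    if S: "S \<subseteq> \<H>" "card S = N" for S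
  proof -
    obtain P where P: "(\<Inter>H\<in>S. proj_points H) = {P}" using meet[OF S] by blast
    have ne: "S \<noteq> {}" using S(2) N by auto
    then obtain H where "H \<in> S" by blast
    then have "P \<in> proj_points H" using P by blast
    then have PL: "vec.subspace P" "vec.dim P = 1" by (auto simp: proj_points_def)
    then obtain p where p: "p \<in> P" "p \<noteq> 0"
      by (metis One_nat_def vec.dim_eq_0 nat.distinct(1) singletonI subsetI)
    obtain w where w: "dot w p = 1" using separating_functional[of p "{}"] p(2) by auto
    have "\<exists>c. x = c *s p" if x: "\<forall>b\<in>Y \<union> a ` S. dot b x = 0" for x
    proof (cases "x = 0")
      case True
      then show ?thesis by (intro exI[of _ 0]) simp
    next
      case False
      have "\<forall>H\<in>S. x \<in> H" using cut[OF S(1) ne] x by blast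
      then have "vec.span {x} = P" using line[OF S(1) _ False] P by blast
      then have "p \<in> vec.span {x}" using p by simp
      then obtain c where c: "p = c *s x" by (auto simp: vec.span_singleton)
      then have "x = inverse c *s p" using p(2) by (simp add: vector_smult_assoc)
      then show ?thesis by blast
    qed
    moreover have "P \<in> Z" unfolding Z using S P by blast
    ultimately show ?thesis using p(1) w by blast
  qed
  have subset_A: "\<exists>S\<subseteq>\<H>. T = a ` S \<and> card T = card S" if "T \<subseteq> ?A" for T
    using that inj by (metis card_image inj_on_subset subset_imageE)
  show ?thesis
  proof
    show "finite Y" "Y \<inter> ?A = {}" by fact+
    show "finite ?A" using \<H>(1) by simp
    show "N \<le> card ?A" using \<H>(2) inj by (simp add: card_image)
    show "\<exists>P\<in>Z. point_ideal P \<subseteq> idl (lin ` (Y \<union> T))" if T: "T \<subseteq> ?A" "card T = N" for T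
    proof -
      obtain S where S: "S \<subseteq> \<H>" "T = a ` S" "card S = N" using subset_A[OF T(1)] T(2) by auto
      obtain P p w where P: "P \<in> Z" "p \<in> P" "dot w p = 1"
          "\<And>x. (\<forall>b\<in>Y \<union> T. dot b x = 0) \<Longrightarrow> \<exists>c. x = c *s p"
        using point[OF S(1,3)] S(2) by blast
      have "b \<in> vec.span (Y \<union> T)" if "dot b p = 0" for b
        by (rule span_if_annihilated) (use P(4) that in \<open>force simp: dot_scale\<close>)
      then have "f \<in> idl (lin ` (Y \<union> T))" if "is_form f" "\<forall>x\<in>P. poly_eval x f = 0" for f
        using form_in_linear_ideal[OF that(1) _ P(3)] that(2) P(2) by blast
      then have "point_ideal P \<subseteq> idl (lin ` (Y \<union> T))"
        unfolding point_ideal_def genideal_eq_idl by (intro idl_subset_ideal[OF ideal_idl]) blast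
      then show ?thesis using P(1) by blast
    qed
    show "vec.independent (Y \<union> T)" if T: "T \<subseteq> ?A" "card T = N \<or> card T = N + 1" for T
    proof -
      obtain S where S: "S \<subseteq> \<H>" "T = a ` S" "card T = card S" using subset_A[OF T(1)] by blast
      have finT: "finite T" using T(1) \<H>(1) finite_subset by blast
      from T(2) show ?thesis
      proof
        assume card: "card T = N"
        obtain P p w where P: "dot w p = 1"
            "\<And>x. (\<forall>b\<in>Y \<union> T. dot b x = 0) \<Longrightarrow> \<exists>c. x = c *s p"
          using point[OF S(1)] S card by metis
        have "vec.independent (insert w (Y \<union> T))"
        proof (rule spanning_independent)
          fix x assume x: "\<forall>b\<in>insert w (Y \<union> T). dot b x = 0"
          then obtain c where "x = c *s p" using P(2) by blast
          then show "x = 0" using x P(1) by (simp add: dot_scale)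
        next
          have "card (insert w (Y \<union> T)) \<le> Suc (card (Y \<union> T))" by (rule card_insert_le_m1) auto
          then show "card (insert w (Y \<union> T)) \<le> CARD('v)"
            using small[OF S(1)] S card NV by simp
        qed (use Y(1) finT in auto)
        then show ?thesis by (rule vec.independent_mono) blast
      next
        assume card: "card T = N + 1"
        then have ne: "S \<noteq> {}" using S by auto
        show ?thesis
        proof (rule spanning_independent)
          fix x assume "\<forall>b\<in>Y \<union> T. dot b x = 0"
          then have H: "\<forall>H\<in>S. x \<in> H" using cut[OF S(1) ne] S(2) by blast
          have "(\<Inter>H\<in>S. proj_points H) = {}" using nomeet[OF S(1)] S(3) card by simp
          then show "x = 0" using line[OF S(1) H] by (metis empty_iff)
        next
          show "card (Y \<union> T) \<le> CARD('v)" using small[OF S(1)] S card NV by simp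
        qed (use Y(1) finT in auto)
      qed
    qed
    show "\<exists>T\<subseteq>?A. card T = N \<and> (\<forall>b\<in>Y \<union> T. \<forall>x\<in>P. dot b x = 0)" if P: "P \<in> Z" for P
    proof -
      obtain S where S: "S \<subseteq> \<H>" "card S = N" "\<And>H. H \<in> S \<Longrightarrow> P \<in> proj_points H"
        using P unfolding Z by auto
      have ne: "S \<noteq> {}" using S(2) N by auto
      have "\<forall>H\<in>S. x \<in> H" if "x \<in> P" for x using S(3) that unfolding proj_points_def by blast
      then have "\<forall>b\<in>Y \<union> a ` S. dot b x = 0" if "x \<in> P" for x using cut[OF S(1) ne] that by blast
      moreover have "card (a ` S) = N" using S inj by (metis card_image inj_on_subset)
      ultimately show ?thesis using S(1) by (intro exI[of _ "a ` S"]) blast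
    qed
  qed
qed

section \<open>Monomials in the forms of a star configuration\<close>

lemma exists_subexponent:
  fixes e :: "'a \<Rightarrow> nat"
  assumes "finite S" "r \<le> sum e S"
  shows "\<exists>e'. (\<forall>a. e' a \<le> e a) \<and> sum e' S = r"
  using assms
proof (induction S arbitrary: r)
  case empty
  then show ?case by (intro exI[of _ "\<lambda>_. 0"]) simp
next
  case (insert a S)
  have "r - min r (e a) \<le> sum e S" using insert.prems insert.hyps by simp
  then obtain e' where e': "\<forall>b. e' b \<le> e b" "sum e' S = r - min r (e a)"
    using insert.IH by blast
  have "sum (e'(a := min r (e a))) S = sum e' S"
    using insert.hyps(2) by (intro sum.cong) auto
  then have "sum (e'(a := min r (e a))) (insert a S) = r"
    using e'(2) insert.hyps by simp
  then show ?case using e'(1) by (intro exI[of _ "e'(a := min r (e a))"]) simp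
qed

lemma mon_Un:
  "finite Y \<Longrightarrow> finite A \<Longrightarrow> Y \<inter> A = {} \<Longrightarrow> mon (Y \<union> A) e = mon Y e * mon A e"
  unfolding mon_def by (rule prod.union_disjoint)

lemma mon_add: "mon E (\<lambda>a. e a + e' a) = mon E e * mon E e'"
  by (simp add: mon_def power_add prod.distrib)

text \<open>
  If the exponents of \<open>Y\<close> add up to at least \<open>r\<close>, then \<open>r\<close> factors from \<open>Y\<close> suffice.
  Otherwise put \<open>t = r - sum e Y\<close>.  Fewer than \<open>N\<close> exponents in \<open>A\<close> are below \<open>t\<close>, so the \<open>t\<close>-th
  power of a product of \<open>card A - N + 1\<close> forms divides the monomial, and the factors left over
  are counted on the remaining \<open>N - 1\<close> forms together with any one of the chosen ones.
\<close>

lemma star_monomial_mem: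
  fixes Y A :: "('k::field^'v::finite) set"
  assumes I: "ideal I coord_ring" and M: "ideal M coord_ring"
    and lin_M: "\<And>a :: 'k^'v. lin a \<in> M"
    and lin_I: "\<And>y. y \<in> Y \<Longrightarrow> lin y \<in> I"
    and prod_I: "\<And>S. S \<subseteq> A \<Longrightarrow> card S + N = card A + 1 \<Longrightarrow> (\<Prod>a\<in>S. lin a) \<in> I"
    and fin: "finite Y" "finite A" and disj: "Y \<inter> A = {}"
    and N: "1 \<le> N" "N \<le> card A" "N \<le> d"
    and r: "1 \<le> r" and m: "(r - 1) * d + 1 \<le> m"
    and e: "\<And>T. T \<subseteq> A \<Longrightarrow> card T = N \<Longrightarrow> m \<le> sum e (Y \<union> T)"
  shows "mon (Y \<union> A) e \<in> ideal_mult (ideal_pow M (m - r)) (ideal_pow I r)"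
proof -
  have e': "m \<le> sum e Y + sum e T" if "T \<subseteq> A" "card T = N" for T
    using e[OF that] sum.union_disjoint[of Y T e] fin disj that(1) finite_subset by fastforce
  show ?thesis
  proof (cases "r \<le> sum e Y")
    case True
    then obtain f where f: "\<forall>a. f a \<le> e a" "sum f Y = r" using exists_subexponent fin by blast
    have "mon Y e = mon Y (\<lambda>a. e a - f a) * mon Y f"
      using f(1) by (simp flip: mon_add)
    then have eq: "mon (Y \<union> A) e = (mon Y (\<lambda>a. e a - f a) * mon A e) * mon Y f"
      using mon_Un[OF fin disj] by (simp add: mult_ac)
    obtain T where T: "T \<subseteq> A" "card T = N" using N(2) fin(2) by (metis obtain_subset_with_card_n)
    have "sum e T \<le> sum e A" using T fin by (intro sum_mono2) auto
    then have "m - r \<le> (sum e Y - r) + sum e A" using e'[OF T] True by linarith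
    also have "sum e Y - r = (\<Sum>a\<in>Y. e a - f a)"
      using f by (simp add: sum_subtractf_nat)
    finally have "m - r \<le> (\<Sum>a\<in>Y. e a - f a) + sum e A" .
    moreover have "mon Y (\<lambda>a. e a - f a) * mon A e
        \<in> ideal_pow M ((\<Sum>a\<in>Y. e a - f a) + sum e A)"
      by (intro ideal_pow_mult[OF M] mon_in_ideal_pow[OF M] fin lin_M order_refl)
    ultimately have "mon Y (\<lambda>a. e a - f a) * mon A e \<in> ideal_pow M (m - r)"
      using ideal_pow_antimono[OF M] by blast
    moreover have "mon Y f \<in> ideal_pow I r"
      by (intro mon_in_ideal_pow[OF I] fin lin_I) (use f(2) in auto)
    ultimately show ?thesis unfolding eq by (rule ideal_mult_mem)
  next
    case False
    define t where "t = r - sum e Y"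
    have t: "sum e Y + t = r" "1 \<le> t" using False by (auto simp: t_def)
    let ?S = "{a\<in>A. t \<le> e a}"
    \<comment> \<open>Otherwise \<open>N\<close> exponents are at most \<open>t - 1\<close>, and
      with \<open>N \<le> d\<close> the order there is at most
      \<open>d * (sum e Y + t - 1) = (r - 1) * d\<close>. This is the source of the lower bound on
      \<open>m\<close>.\<close>
    have "card (A - ?S) < N"
    proof (rule ccontr)
      assume "\<not> card (A - ?S) < N"
      then have "N \<le> card (A - ?S)" by simp
      then obtain T where T: "T \<subseteq> A - ?S" "card T = N"
        by (rule obtain_subset_with_card_n)
      have "e a \<le> t - 1" if "a \<in> T" for a using that T by fastforce
      then have "sum e T \<le> N * (t - 1)" using sum_bounded_above[of T e "t - 1"] T(2) by simp
      then have "m \<le> sum e Y + N * (t - 1)" using e'[of T] T by fastforce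
      also have "\<dots> \<le> d * sum e Y + d * (t - 1)"
        using N by (intro add_mono mult_right_mono) auto
      also have "\<dots> = (r - 1) * d" using t by (metis Nat.add_diff_assoc add_mult_distrib2 mult.commute)
      finally show False using m by simp
    qed
    moreover have "card A = card ?S + card (A - ?S)"
      using fin(2) card_Un_disjoint[of ?S "A - ?S"] by (simp add: Un_absorb1)
    ultimately have "card A + 1 - N \<le> card ?S" by linarith
    then obtain S where S: "S \<subseteq> ?S" "card S = card A + 1 - N"
      by (rule obtain_subset_with_card_n)
    have SA: "S \<subseteq> A" using S(1) by blast
    have finS: "finite S" using SA fin(2) finite_subset by blast
    define f where "f = (\<lambda>a. if a \<in> S then e a - t else e a)"
    have "e a = f a + (if a \<in> S then t else 0)" for a using S(1) by (auto simp: f_def)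
    then have "mon A e = mon A (\<lambda>a. f a + (if a \<in> S then t else 0))" by (intro mon_cong)
    also have "\<dots> = mon A f * mon A (\<lambda>a. if a \<in> S then t else 0)" by (rule mon_add)
    also have "mon A (\<lambda>a. if a \<in> S then t else 0) = (\<Prod>a\<in>A \<inter> S. lin a ^ t)"
      unfolding mon_def prod.inter_restrict[OF fin(2)] by (rule prod.cong) auto
    also have "A \<inter> S = S" using SA by blast
    finally have eq: "mon (Y \<union> A) e = mon A f * (mon Y e * (\<Prod>a\<in>S. lin a) ^ t)"
      using mon_Un[OF fin disj] by (simp add: prod_power_distrib mult_ac)
    have "S \<noteq> {}" using S(2) N(2) by auto
    then obtain x where x: "x \<in> S" by blast
    \<comment> \<open>Dividing by the \<open>t\<close>-th power of the product over \<open>S\<close>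
      costs only \<open>t\<close> on this set, since \<open>x\<close> is its only element in
      \<open>S\<close>.\<close>
    let ?T = "insert x (A - S)"
    have finT: "finite ?T" using fin(2) by simp
    have "card (A - S) = card A - card S" using SA finS by (rule card_Diff_subset[rotated])
    then have "card ?T = N"
      using x fin(2) S(2) N by simp
    then have "m \<le> sum e Y + sum e ?T" using e'[of ?T] SA x by blast
    moreover have "sum e ?T = sum f ?T + t"
    proof -
      have "sum f (A - S) = sum e (A - S)" by (rule sum.cong) (auto simp: f_def)
      moreover have "e x = f x + t" using x S(1) by (auto simp: f_def)
      ultimately show ?thesis using x fin(2) by simp
    qed
    moreover have "sum f ?T \<le> sum f A" using fin SA x by (intro sum_mono2) auto
    ultimately have "m - r \<le> sum f A" using t by linarith
    then have "mon A f \<in> ideal_pow M (m - r)" by (intro mon_in_ideal_pow[OF M] fin lin_M)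
    moreover have "mon Y e * (\<Prod>a\<in>S. lin a) ^ t \<in> ideal_pow I (sum e Y + t)"
    proof (rule ideal_pow_mult[OF I])
      show "mon Y e \<in> ideal_pow I (sum e Y)" by (intro mon_in_ideal_pow[OF I] fin lin_I order_refl)
      have "card S + N = card A + 1" using S(2) N(2) by simp
      then show "(\<Prod>a\<in>S. lin a) ^ t \<in> ideal_pow I t"
        by (intro ideal_pow_mem[OF I] prod_I[OF SA])
    qed
    then have "mon Y e * (\<Prod>a\<in>S. lin a) ^ t \<in> ideal_pow I r" by (simp only: t(1))
    ultimately show ?thesis unfolding eq by (rule ideal_mult_mem)
  qed
qed

section \<open>From the monomial count to the containment\<close>

lemma ideal_Inter_idl: "ideal (\<Inter>P\<in>Z. idl (G P)) (ring_of_type_algebra :: 'a::comm_ring_1 ring)"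
proof -
  have "idl (\<Inter>P\<in>Z. idl (G P)) = (\<Inter>P\<in>Z. idl (G P))"
  proof
    show "idl (\<Inter>P\<in>Z. idl (G P)) \<subseteq> (\<Inter>P\<in>Z. idl (G P))"
      by (intro INT_greatest idl_subset_ideal[OF ideal_idl] INT_lower)
  qed (auto intro: idl_base)
  then show ?thesis using ideal_idl[of "\<Inter>P\<in>Z. idl (G P)"] by simp
qed

lemma symbolic_power_subset:
  fixes W :: "('k::field^'v::finite) set"
  assumes star: "star_configuration N W Z" and N: "1 \<le> N" "N \<le> d"
    and r: "1 \<le> r" and m: "(r - 1) * d + 1 \<le> m"
  shows "symbolic_power Z m \<subseteq> ideal_mult (ideal_pow irrelevant_ideal (m - r)) (ideal_pow (radical_ideal Z) r)"
proof
  fix f assume f: "f \<in> symbolic_power Z m"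
  obtain Y A :: "('k^'v) set" where fin: "finite Y" "finite A" and disj: "Y \<inter> A = {}" and NA: "N \<le> card A"
    and gens: "\<And>T. T \<subseteq> A \<Longrightarrow> card T = N \<Longrightarrow> \<exists>P\<in>Z. point_ideal P \<subseteq> idl (lin ` (Y \<union> T))"
    and ind: "\<And>T. T \<subseteq> A \<Longrightarrow> card T = N \<or> card T = N + 1 \<Longrightarrow> vec.independent (Y \<union> T)"
    and vanish: "\<And>P. P \<in> Z \<Longrightarrow> \<exists>T\<subseteq>A. card T = N \<and> (\<forall>a\<in>Y \<union> T. \<forall>x\<in>P. dot a x = 0)"
    using star_configuration_forms[OF star N(1)] by blast
  have point_ideal: "ideal (point_ideal P) coord_ring" for P :: "('k^'v) set"
    unfolding point_ideal_def genideal_eq_idl by (rule ideal_idl)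
  have I: "ideal (radical_ideal Z) coord_ring"
    unfolding radical_ideal_def point_ideal_def genideal_eq_idl by (rule ideal_Inter_idl)
  have M: "ideal (irrelevant_ideal :: ('k, 'v) mpoly set) coord_ring"
    unfolding irrelevant_ideal_def genideal_eq_idl by (rule ideal_idl)
  have form_I: "g \<in> radical_ideal Z"
    if "is_form g" "\<And>P x. P \<in> Z \<Longrightarrow> x \<in> P \<Longrightarrow> poly_eval x g = 0" for g
    using that unfolding radical_ideal_def point_ideal_def genideal_eq_idl by (blast intro: idl_base)
  let ?Q = "ideal_mult (ideal_pow irrelevant_ideal (m - r)) (ideal_pow (radical_ideal Z) r)"
  let ?\<T> = "{Y \<union> T |T. T \<subseteq> A \<and> card T = N}"
  let ?E = "Y \<union> A"
  have finT: "finite T" if "T \<subseteq> A" for T using that fin(2) finite_subset by blast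
  \<comment> \<open>The matroid is the uniform one of rank \<open>N\<close> on \<open>A\<close> with
    \<open>Y\<close> added to every basis; nothing has been contracted and all weights are
    zero.\<close>
  have "f \<in> idl ({mon ?E e |e. \<forall>T\<in>?\<T>. m \<le> sum e T + sum (\<lambda>_. 0) T} \<union> lin ` {})"
  proof (rule matroid_symbolic_power)
    show "finite ?E" using fin by simp
    show "T \<subseteq> ?E \<and> card T = card Y + N" if T: "T \<in> ?\<T>" for T
    proof -
      obtain S where S: "T = Y \<union> S" "S \<subseteq> A" "card S = N" using T by auto
      then have "card T = card Y + card S"
        using fin finT[OF S(2)] disj by (auto intro: card_Un_disjoint)
      then show ?thesis using S by blast
    qed
    show "vec.independent (insert s T \<union> {})" if T: "T \<in> ?\<T>" "s \<in> \<Union>?\<T>" for T s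
    proof -
      obtain S where S: "T = Y \<union> S" "S \<subseteq> A" "card S = N" using T(1) by auto
      have "s \<in> ?E" using T(2) by auto
      show ?thesis
      proof (cases "s \<in> T")
        case True
        then show ?thesis using ind[OF S(2)] S by (simp add: insert_absorb)
      next
        case False
        then have "s \<in> A" "s \<notin> S" using S(1) \<open>s \<in> ?E\<close> by auto
        then have "vec.independent (Y \<union> insert s S)"
          using S finT[OF S(2)] by (intro ind) auto
        then show ?thesis using S(1) by simp
      qed
    qed
    show "?E \<inter> {} = {}" by simp
    show "\<exists>j\<in>T - T'. insert s (T - {j}) \<in> ?\<T>"
      if T: "T \<in> ?\<T>" "T' \<in> ?\<T>" and s: "s \<in> T' - T" for T T' s
    proof -
      obtain S where S: "T = Y \<union> S" "S \<subseteq> A" "card S = N" using T(1) by auto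
      obtain S' where S': "T' = Y \<union> S'" "S' \<subseteq> A" "card S' = N" using T(2) by auto
      have sS: "s \<in> S'" "s \<notin> S" using s S(1) S'(1) by auto
      have "\<not> S \<subseteq> S'"
        using card_subset_eq[OF finT[OF S'(2)], of S] S(3) S'(3) sS by auto
      then obtain j where j: "j \<in> S" "j \<notin> S'" by blast
      have jY: "j \<notin> Y" using j(1) S(2) disj by blast
      have "insert s (T - {j}) = Y \<union> insert s (S - {j})" using S(1) jY by auto
      moreover have "card (insert s (S - {j})) = N"
        using S(3) sS(2) j(1) finT[OF S(2)] N(1) by (simp add: card_Diff_singleton)
      moreover have "insert s (S - {j}) \<subseteq> A" using S(2) S'(2) sS(1) by blast
      ultimately have "insert s (T - {j}) \<in> ?\<T>" by blast
      moreover have "j \<in> T - T'" using j jY S(1) S'(1) by blast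
      ultimately show ?thesis by blast
    qed
    show "f \<in> vanishing_ideal T (m - sum (\<lambda>_. 0) T) {}" if T: "T \<in> ?\<T>" for T
    proof -
      obtain S where S: "T = Y \<union> S" "S \<subseteq> A" "card S = N" using T by auto
      obtain P where P: "P \<in> Z" "point_ideal P \<subseteq> idl (lin ` T)" using gens[OF S(2,3)] S(1) by blast
      have "f \<in> ideal_pow (point_ideal P) m" using f P(1) unfolding symbolic_power_def by blast
      moreover have "finite T" using S fin(1) finT by simp
      ultimately show ?thesis
        using ideal_pow_subset_vanishing_ideal[OF point_ideal _ P(2)] by auto
    qed
  qed
  moreover have "mon ?E e \<in> ?Q" if e: "\<forall>T\<in>?\<T>. m \<le> sum e T + sum (\<lambda>_. 0) T" for e
  proof (rule star_monomial_mem[OF I M, where d = d and N = N])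
    show "lin a \<in> irrelevant_ideal" for a :: "'k^'v"
      unfolding lin_def irrelevant_ideal_def genideal_eq_idl
      by (intro idl_sum idl_mult idl_base) auto
    show "lin y \<in> radical_ideal Z" if "y \<in> Y" for y
      using vanish that by (intro form_I is_form_lin) (auto simp: poly_eval_lin)
    show "(\<Prod>a\<in>S. lin a) \<in> radical_ideal Z" if S: "S \<subseteq> A" "card S + N = card A + 1" for S
    proof (intro form_I is_form_prod is_form_lin)
      fix P x assume P: "P \<in> Z" "x \<in> P"
      obtain T where T: "T \<subseteq> A" "card T = N" "\<forall>a\<in>Y \<union> T. \<forall>x\<in>P. dot a x = 0"
        using vanish[OF P(1)] by blast
      have "S \<inter> T \<noteq> {}"
      proof
        assume "S \<inter> T = {}"
        then have "card (S \<union> T) = card S + card T" using finT S(1) T(1) by (intro card_Un_disjoint)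
        moreover have "card (S \<union> T) \<le> card A" using S(1) T(1) fin(2) by (intro card_mono) auto
        ultimately show False using S(2) T(2) by simp
      qed
      then obtain a where a: "a \<in> S" "a \<in> T" by blast
      then have "poly_eval x (lin a) = 0" using T(3) P(2) by (simp add: poly_eval_lin)
      then show "poly_eval x (\<Prod>a\<in>S. lin a) = 0" using poly_eval_prod[OF finT[OF S(1)] a(1)] by blast
    qed
    show "m \<le> sum e (Y \<union> T)" if "T \<subseteq> A" "card T = N" for T
    proof -
      have "Y \<union> T \<in> ?\<T>" using that by blast
      then have "m \<le> sum e (Y \<union> T) + sum (\<lambda>_. 0) (Y \<union> T)" by (rule bspec[OF e])
      then show ?thesis by simp
    qed
  qed (fact fin disj N NA r m)+
  moreover have "ideal ?Q coord_ring"
  proof -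
    interpret ring "coord_ring :: ('k, 'v) mpoly ring" by (rule ring_from_type_algebra)
    show ?thesis
      using ideal_prod_is_ideal[OF ideal_ideal_pow[OF M] ideal_ideal_pow[OF I]] by (simp add: ideals_set_def)
  qed
  ultimately show "f \<in> ?Q"
    using idl_subset_ideal[of ?Q "{mon ?E e |e. \<forall>T\<in>?\<T>. m \<le> sum e T + sum (\<lambda>_. 0) T} \<union> lin ` {}"]
    by (simp only: image_empty Un_empty_right) (blast)
qed

theorem theorem7p2:
  fixes W :: "('k::{alg_closed_field, field_char_0}^'v::finite) set"
    and Z :: "('k^'v) set set"
    and N d r :: nat
  assumes "CARD('v) = d + 1"
    and "1 \<le> N" and "N < d"
    and "star_configuration N W Z"
    and "1 \<le> r"
  shows "symbolic_power Z (r * d) \<subseteq>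
           ideal_mult (ideal_pow irrelevant_ideal (r * (d - 1))) (ideal_pow (radical_ideal Z) r)
       \<and> symbolic_power Z (r * d - (d - 1)) \<subseteq>
           ideal_mult (ideal_pow irrelevant_ideal ((r - 1) * (d - 1))) (ideal_pow (radical_ideal Z) r)"
proof -
  have d: "1 \<le> d" "N \<le> d" using assms by auto
  \<comment> \<open>Successor form removes the truncated subtractions. The order
    \<open>r * d - (d - 1)\<close> in the second part equals the threshold
    \<open>(r - 1) * d + 1\<close>.\<close>
  obtain q where q: "r = q + 1" using assms(5) by (metis le_add_diff_inverse2)
  obtain c where c: "d = c + 1" using d(1) by (metis le_add_diff_inverse2)
  have "(r - 1) * d + 1 \<le> r * d" "r * d - r = r * (d - 1)"
    "(r - 1) * d + 1 \<le> r * d - (d - 1)" "r * d - (d - 1) - r = (r - 1) * (d - 1)"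
    unfolding q c by (simp_all add: algebra_simps)
  then show ?thesis
    using symbolic_power_subset[OF assms(4,2) d(2) assms(5)] by metis
qed

end
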